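(* Let $(M,J,g,F)$ be an almost Hermitian manifold of real dimension $m=2n$, let $f\in C^\infty(M)$ be real-valued, and let $\tilde g=e^{2f}g$. Let $s^C,s$ be the Chern and third scalar curvatures of $(J,g)$, and $\tilde s^C,\tilde s$ those of $(J,\tilde g)$. Then $$e^{2f}\tilde{s}^C = s^C - n\, \Lambda(dd^cf),\qquad e^{2f}\tilde{s} = s - \Lambda(dd^cf).$$
   Context: $J$ is an almost complex structure orthogonal for $g$, and $F=g(J\cdot,\cdot)$. The Chern connection $\nabla$ is the unique connection on $TM$ with $\nabla g=0$, $\nabla J=0$ whose torsion $T_{XY}=\nabla_XY-\nabla_YX-[X,Y]$ satisfies $T_{JX,JY}=-T_{XY}$; its curvature is $R_{XY}=[\nabla_X,\nabla_Y]-\nabla_{[X,Y]}$. For a local $g$-orthonormal frame $(e_i)$ with $e_{2\alpha}=Je_{2\alpha-1}$: $s^C=-\frac14\sum_{i,j}g(R_{e_i,Je_i}e_j,Je_j)$, $s=\frac12\sum_{i,j}g(R_{e_i,e_j}e_j,e_i)$, and $\Lambda(\phi)=\frac12\sum_i\phi(e_i,Je_i)$ for a $2$-form $\phi$. Quantities with tilde are defined in the same way from $(J,\tilde g)$. For a function, $d^cf=J\,df=-df\circ J$. *)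

theory Defs
  imports "HOL-Analysis.Analysis"
begin

section \<open>Smooth manifolds\<close>

text \<open>
  On an open set \<open>S\<close> of a Euclidean space, \<open>Ck_on k S f\<close> says that \<open>f\<close> is of class $C^k$:
  all iterated directional derivatives of order at most \<open>k\<close> exist (in the Frechet sense)
  and are continuous.
\<close>

primrec Ck_on :: "nat \<Rightarrow> 'e::euclidean_space set \<Rightarrow> ('e \<Rightarrow> 'f::real_normed_vector) \<Rightarrow> bool" where
  "Ck_on 0 S f \<longleftrightarrow> continuous_on S f"
| "Ck_on (Suc k) S f \<longleftrightarrow> (\<forall>x\<in>S. f differentiable (at x)) \<and>
     (\<forall>v. Ck_on k S (\<lambda>x. frechet_derivative f (at x) v))"

definition smooth_on :: "'e::euclidean_space set \<Rightarrow> ('e \<Rightarrow> 'f::real_normed_vector) \<Rightarrow> bool" where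
  "smooth_on S f \<longleftrightarrow> (\<forall>k. Ck_on k S f)"

text \<open>
  A chart is a pair \<open>(U, \<phi>)\<close> of a domain and a map, only the values of \<open>\<phi>\<close> on \<open>U\<close> being
  relevant. The manifold is the whole type \<open>'a\<close>, Hausdorff and second countable by its sort;
  its real dimension is \<open>DIM('e)\<close>.
\<close>

type_synonym ('a, 'e) atlas = "('a set \<times> ('a \<Rightarrow> 'e)) set"

definition smooth_atlas ::
  "('a::{t2_space,second_countable_topology}, 'e::euclidean_space) atlas \<Rightarrow> bool" where
  "smooth_atlas A \<longleftrightarrow>
     (\<forall>(U, \<phi>)\<in>A. open U \<and> open (\<phi> ` U) \<and> homeomorphism U (\<phi> ` U) \<phi> (inv_into U \<phi>)) \<and>
     (\<Union>(U, \<phi>)\<in>A. U) = UNIV \<and>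
     (\<forall>(U, \<phi>)\<in>A. \<forall>(V, \<psi>)\<in>A. smooth_on (\<phi> ` (U \<inter> V)) (\<psi> \<circ> inv_into U \<phi>))"

definition smooth_fun ::
  "('a::{t2_space,second_countable_topology}, 'e::euclidean_space) atlas \<Rightarrow> 'a set \<Rightarrow>
     ('a \<Rightarrow> real) \<Rightarrow> bool" where
  "smooth_fun A W h \<longleftrightarrow> open W \<and> (\<forall>(U, \<phi>)\<in>A. smooth_on (\<phi> ` (U \<inter> W)) (h \<circ> inv_into U \<phi>))"

definition smooth_near ::
  "('a::{t2_space,second_countable_topology}, 'e::euclidean_space) atlas \<Rightarrow> 'a \<Rightarrow>
     ('a \<Rightarrow> real) \<Rightarrow> bool" where
  "smooth_near A p h \<longleftrightarrow> (\<exists>W. p \<in> W \<and> smooth_fun A W h)"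

text \<open>
  Tangent vectors at \<open>p\<close> are the derivations at \<open>p\<close> of the algebra of germs of smooth functions.
  They are represented as functionals on all functions, required to depend only on the germ;
  the value \<open>0\<close> on functions that are not smooth near \<open>p\<close> is a normalization that makes
  equality of tangent vectors the equality of functionals.
\<close>

type_synonym 'a tangent = "('a \<Rightarrow> real) \<Rightarrow> real"

definition tangent_space ::
  "('a::{t2_space,second_countable_topology}, 'e::euclidean_space) atlas \<Rightarrow> 'a \<Rightarrow>
     'a tangent set" where
  "tangent_space A p = {v.
     (\<forall>h. \<not> smooth_near A p h \<longrightarrow> v h = 0) \<and>
     (\<forall>h k. smooth_near A p h \<and> smooth_near A p k \<and> (\<forall>\<^sub>F q in nhds p. h q = k q) \<longrightarrow> v h = v k) \<and>
     (\<forall>h k a b. smooth_near A p h \<and> smooth_near A p k \<longrightarrow>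
        v (\<lambda>q. a * h q + b * k q) = a * v h + b * v k) \<and>
     (\<forall>h k. smooth_near A p h \<and> smooth_near A p k \<longrightarrow>
        v (\<lambda>q. h q * k q) = v h * k p + h p * v k)}"

text \<open>
  A vector field on an open set \<open>U\<close> is a total function, of which only the values on \<open>U\<close> are
  relevant.
\<close>

type_synonym 'a vfield = "'a \<Rightarrow> 'a tangent"

definition vector_field ::
  "('a::{t2_space,second_countable_topology}, 'e::euclidean_space) atlas \<Rightarrow> 'a set \<Rightarrow>
     'a vfield \<Rightarrow> bool" where
  "vector_field A U X \<longleftrightarrow> open U \<and> (\<forall>p\<in>U. X p \<in> tangent_space A p) \<and>
     (\<forall>V h. V \<subseteq> U \<and> smooth_fun A V h \<longrightarrow> smooth_fun A V (\<lambda>p. X p h))"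

definition vf_lin :: "('a \<Rightarrow> real) \<Rightarrow> 'a vfield \<Rightarrow> ('a \<Rightarrow> real) \<Rightarrow> 'a vfield \<Rightarrow> 'a vfield" where
  "vf_lin a X b Y = (\<lambda>p h. a p * X p h + b p * Y p h)"

text \<open>The case distinction only enforces the normalization in \<open>tangent_space\<close>.\<close>

definition lie_bracket ::
  "('a::{t2_space,second_countable_topology}, 'e::euclidean_space) atlas \<Rightarrow>
     'a vfield \<Rightarrow> 'a vfield \<Rightarrow> 'a vfield" where
  "lie_bracket A X Y = (\<lambda>p h.
     if smooth_near A p h then X p (\<lambda>q. Y q h) - Y p (\<lambda>q. X q h) else 0)"


section \<open>Almost Hermitian structures\<close>

definition riemannian_metric ::
  "('a::{t2_space,second_countable_topology}, 'e::euclidean_space) atlas \<Rightarrow>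
     ('a \<Rightarrow> 'a tangent \<Rightarrow> 'a tangent \<Rightarrow> real) \<Rightarrow> bool" where
  "riemannian_metric A g \<longleftrightarrow>
     (\<forall>p. \<forall>u\<in>tangent_space A p. \<forall>v\<in>tangent_space A p. g p u v = g p v u) \<and>
     (\<forall>p. \<forall>u\<in>tangent_space A p. \<forall>v\<in>tangent_space A p. \<forall>w\<in>tangent_space A p. \<forall>a b.
        g p (\<lambda>h. a * u h + b * v h) w = a * g p u w + b * g p v w) \<and>
     (\<forall>p. \<forall>u\<in>tangent_space A p. u \<noteq> (\<lambda>h. 0) \<longrightarrow> g p u u > 0) \<and>
     (\<forall>U X Y. vector_field A U X \<and> vector_field A U Y \<longrightarrow>
        smooth_fun A U (\<lambda>p. g p (X p) (Y p)))"

definition app_field :: "('a \<Rightarrow> 'a tangent \<Rightarrow> 'a tangent) \<Rightarrow> 'a vfield \<Rightarrow> 'a vfield" where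
  "app_field J X = (\<lambda>p. J p (X p))"

definition almost_complex_structure ::
  "('a::{t2_space,second_countable_topology}, 'e::euclidean_space) atlas \<Rightarrow>
     ('a \<Rightarrow> 'a tangent \<Rightarrow> 'a tangent) \<Rightarrow> bool" where
  "almost_complex_structure A J \<longleftrightarrow>
     (\<forall>p. \<forall>u\<in>tangent_space A p. J p u \<in> tangent_space A p \<and> J p (J p u) = (\<lambda>h. - u h)) \<and>
     (\<forall>p. \<forall>u\<in>tangent_space A p. \<forall>v\<in>tangent_space A p. \<forall>a b.
        J p (\<lambda>h. a * u h + b * v h) = (\<lambda>h. a * J p u h + b * J p v h)) \<and>
     (\<forall>U X. vector_field A U X \<longrightarrow> vector_field A U (app_field J X))"

definition almost_hermitian ::
  "('a::{t2_space,second_countable_topology}, 'e::euclidean_space) atlas \<Rightarrow>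
     ('a \<Rightarrow> 'a tangent \<Rightarrow> 'a tangent) \<Rightarrow> ('a \<Rightarrow> 'a tangent \<Rightarrow> 'a tangent \<Rightarrow> real) \<Rightarrow>
     ('a \<Rightarrow> 'a tangent \<Rightarrow> 'a tangent \<Rightarrow> real) \<Rightarrow> bool" where
  "almost_hermitian A J g F \<longleftrightarrow>
     smooth_atlas A \<and> almost_complex_structure A J \<and> riemannian_metric A g \<and>
     (\<forall>p. \<forall>u\<in>tangent_space A p. \<forall>v\<in>tangent_space A p. g p (J p u) (J p v) = g p u v) \<and>
     (\<forall>p. \<forall>u\<in>tangent_space A p. \<forall>v\<in>tangent_space A p. F p u v = g p (J p u) v)"


section \<open>Chern connection and curvature\<close>

text \<open>
  A connection on the tangent bundle is regarded as an operator on vector fields over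
  arbitrary open sets, compatible with restriction (the last clause), so that it can be
  evaluated on local frames.
\<close>

definition connection ::
  "('a::{t2_space,second_countable_topology}, 'e::euclidean_space) atlas \<Rightarrow>
     ('a vfield \<Rightarrow> 'a vfield \<Rightarrow> 'a vfield) \<Rightarrow> bool" where
  "connection A D \<longleftrightarrow>
     (\<forall>U X Y. vector_field A U X \<and> vector_field A U Y \<longrightarrow> vector_field A U (D X Y)) \<and>
     (\<forall>U X X' Y a b. vector_field A U X \<and> vector_field A U X' \<and> vector_field A U Y \<and>
        smooth_fun A U a \<and> smooth_fun A U b \<longrightarrow>
        (\<forall>p\<in>U. D (vf_lin a X b X') Y p = vf_lin a (D X Y) b (D X' Y) p)) \<and>
     (\<forall>U X Y Y'. vector_field A U X \<and> vector_field A U Y \<and> vector_field A U Y' \<longrightarrow>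
        (\<forall>p\<in>U. D X (\<lambda>q h. Y q h + Y' q h) p = (\<lambda>h. D X Y p h + D X Y' p h))) \<and>
     (\<forall>U X Y a. vector_field A U X \<and> vector_field A U Y \<and> smooth_fun A U a \<longrightarrow>
        (\<forall>p\<in>U. D X (\<lambda>q h. a q * Y q h) p = (\<lambda>h. X p a * Y p h + a p * D X Y p h))) \<and>
     (\<forall>U X X' Y Y'. vector_field A U X \<and> vector_field A U Y \<and>
        (\<forall>p\<in>U. X' p = X p) \<and> (\<forall>p\<in>U. Y' p = Y p) \<longrightarrow> (\<forall>p\<in>U. D X' Y' p = D X Y p))"

definition torsion ::
  "('a::{t2_space,second_countable_topology}, 'e::euclidean_space) atlas \<Rightarrow>
     ('a vfield \<Rightarrow> 'a vfield \<Rightarrow> 'a vfield) \<Rightarrow> 'a vfield \<Rightarrow> 'a vfield \<Rightarrow> 'a vfield" where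
  "torsion A D X Y = (\<lambda>p h. D X Y p h - D Y X p h - lie_bracket A X Y p h)"

definition curvature ::
  "('a::{t2_space,second_countable_topology}, 'e::euclidean_space) atlas \<Rightarrow>
     ('a vfield \<Rightarrow> 'a vfield \<Rightarrow> 'a vfield) \<Rightarrow>
     'a vfield \<Rightarrow> 'a vfield \<Rightarrow> 'a vfield \<Rightarrow> 'a vfield" where
  "curvature A D X Y Z = (\<lambda>p h.
     D X (D Y Z) p h - D Y (D X Z) p h - D (lie_bracket A X Y) Z p h)"

definition is_chern_connection ::
  "('a::{t2_space,second_countable_topology}, 'e::euclidean_space) atlas \<Rightarrow>
     ('a \<Rightarrow> 'a tangent \<Rightarrow> 'a tangent) \<Rightarrow> ('a \<Rightarrow> 'a tangent \<Rightarrow> 'a tangent \<Rightarrow> real) \<Rightarrow>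
     ('a vfield \<Rightarrow> 'a vfield \<Rightarrow> 'a vfield) \<Rightarrow> bool" where
  "is_chern_connection A J g D \<longleftrightarrow> connection A D \<and>
     (\<forall>U X Y Z. vector_field A U X \<and> vector_field A U Y \<and> vector_field A U Z \<longrightarrow>
        (\<forall>p\<in>U. X p (\<lambda>q. g q (Y q) (Z q)) = g p (D X Y p) (Z p) + g p (Y p) (D X Z p))) \<and>
     (\<forall>U X Y. vector_field A U X \<and> vector_field A U Y \<longrightarrow>
        (\<forall>p\<in>U. D X (app_field J Y) p = app_field J (D X Y) p)) \<and>
     (\<forall>U X Y. vector_field A U X \<and> vector_field A U Y \<longrightarrow>
        (\<forall>p\<in>U. torsion A D (app_field J X) (app_field J Y) p = (\<lambda>h. - torsion A D X Y p h)))"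

text \<open>
  The scalar curvatures and \<open>\<Lambda>\<close> are written with respect to a local adapted frame, indexed
  from 1; their values at a point do not depend on it. Statements about them are to be read
  for all adapted frames near the point in question.
\<close>

definition adapted_frame ::
  "('a::{t2_space,second_countable_topology}, 'e::euclidean_space) atlas \<Rightarrow>
     ('a \<Rightarrow> 'a tangent \<Rightarrow> 'a tangent) \<Rightarrow> ('a \<Rightarrow> 'a tangent \<Rightarrow> 'a tangent \<Rightarrow> real) \<Rightarrow>
     nat \<Rightarrow> 'a set \<Rightarrow> (nat \<Rightarrow> 'a vfield) \<Rightarrow> bool" where
  "adapted_frame A J g n U e \<longleftrightarrow>
     (\<forall>i\<in>{1..2*n}. vector_field A U (e i)) \<and>
     (\<forall>p\<in>U. \<forall>i\<in>{1..2*n}. \<forall>j\<in>{1..2*n}. g p (e i p) (e j p) = (if i = j then 1 else 0)) \<and>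
     (\<forall>p\<in>U. \<forall>v\<in>tangent_space A p. \<exists>c. v = (\<lambda>h. \<Sum>i=1..2*n. c i * e i p h)) \<and>
     (\<forall>p\<in>U. \<forall>\<alpha>\<in>{1..n}. e (2*\<alpha>) p = J p (e (2*\<alpha> - 1) p))"

definition chern_scalar_curvature ::
  "('a::{t2_space,second_countable_topology}, 'e::euclidean_space) atlas \<Rightarrow>
     ('a \<Rightarrow> 'a tangent \<Rightarrow> 'a tangent) \<Rightarrow> ('a \<Rightarrow> 'a tangent \<Rightarrow> 'a tangent \<Rightarrow> real) \<Rightarrow>
     ('a vfield \<Rightarrow> 'a vfield \<Rightarrow> 'a vfield) \<Rightarrow> nat \<Rightarrow> (nat \<Rightarrow> 'a vfield) \<Rightarrow> 'a \<Rightarrow> real" where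
  "chern_scalar_curvature A J g D n e p =
     - (1/4) * (\<Sum>i=1..2*n. \<Sum>j=1..2*n.
        g p (curvature A D (e i) (app_field J (e i)) (e j) p) (J p (e j p)))"

definition third_scalar_curvature ::
  "('a::{t2_space,second_countable_topology}, 'e::euclidean_space) atlas \<Rightarrow>
     ('a \<Rightarrow> 'a tangent \<Rightarrow> 'a tangent \<Rightarrow> real) \<Rightarrow>
     ('a vfield \<Rightarrow> 'a vfield \<Rightarrow> 'a vfield) \<Rightarrow> nat \<Rightarrow> (nat \<Rightarrow> 'a vfield) \<Rightarrow> 'a \<Rightarrow> real" where
  "third_scalar_curvature A g D n e p =
     1/2 * (\<Sum>i=1..2*n. \<Sum>j=1..2*n. g p (curvature A D (e i) (e j) (e j) p) (e i p))"


section \<open>The operators \<open>d\<^sup>c\<close>, \<open>d\<close> and \<open>\<Lambda>\<close>\<close>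

text \<open>The differential of \<open>f\<close> is \<open>v \<mapsto> v f\<close>, so \<open>d\<^sup>c f = - df \<circ> J\<close> reads as follows.\<close>

definition dc :: "('a \<Rightarrow> 'a tangent \<Rightarrow> 'a tangent) \<Rightarrow> ('a \<Rightarrow> real) \<Rightarrow> 'a \<Rightarrow> 'a tangent \<Rightarrow> real" where
  "dc J f p v = - J p v f"

text \<open>Exterior derivative of a 1-form, in the convention without the factor \<open>1/2\<close>.\<close>

definition ext_deriv ::
  "('a::{t2_space,second_countable_topology}, 'e::euclidean_space) atlas \<Rightarrow>
     ('a \<Rightarrow> 'a tangent \<Rightarrow> real) \<Rightarrow> 'a vfield \<Rightarrow> 'a vfield \<Rightarrow> 'a \<Rightarrow> real" where
  "ext_deriv A \<alpha> X Y p =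
     X p (\<lambda>q. \<alpha> q (Y q)) - Y p (\<lambda>q. \<alpha> q (X q)) - \<alpha> p (lie_bracket A X Y p)"

definition Lambda ::
  "('a \<Rightarrow> 'a tangent \<Rightarrow> 'a tangent) \<Rightarrow> nat \<Rightarrow> (nat \<Rightarrow> 'a vfield) \<Rightarrow>
     ('a vfield \<Rightarrow> 'a vfield \<Rightarrow> 'a \<Rightarrow> real) \<Rightarrow> 'a \<Rightarrow> real" where
  "Lambda J n e \<phi> p = 1/2 * (\<Sum>i=1..2*n. \<phi> (e i) (app_field J (e i)) p)"

end

theory Submission
  imports Defs
begin

text \<open>
  Write \<open>\<eta> = d\<^sup>c f\<close>. The Chern connection of \<open>e\<^sup>2\<^sup>f g\<close> has the closed form
  \<open>D\<^sub>X Y + df(X) Y + \<eta>(X) J Y\<close>: the term \<open>df(X) Y\<close> accounts for the derivative of the conformal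
  factor, \<open>\<eta>(X) J\<close> is skew and commutes with \<open>J\<close>, and because \<open>\<eta>(JX) = df(X)\<close> the two terms
  together change the torsion only by a \<open>J\<close>-anti-invariant amount. That no other connection
  qualifies is the algebraic fact \<open>chern_difference_vanishes\<close>, applied to the difference of two
  candidates; this gives \<open>conformal_chern_connection\<close>.

  The identity and \<open>J\<close> are both parallel and commute, so passing to curvatures only adds
  the exterior derivatives of the two scalar 1-forms, \<open>d(df) id + d\<eta> J = d\<eta> J\<close>
  (\<open>conformal_curvature\<close>). In the first scalar curvature the endomorphism \<open>J\<close> is paired with
  itself over all \<open>2n\<close> vectors of the frame, which multiplies \<open>\<Lambda> d\<eta>\<close> by \<open>n\<close>; in the third one it
  is contracted with the arguments of \<open>d\<eta>\<close>, which yields \<open>\<Lambda> d\<eta>\<close> once.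

  The frame adapted to the new metric need not be \<open>e\<^sup>-\<^sup>f\<close> times the given one, so the
  scalar curvatures have to be recognised as traces independent of the frame. Curvature is linear
  over smooth functions in every slot (\<open>curvature_tensorial\<close>), hence may be expanded in a frame, and
  Parseval's identity for the new frame shows that each trace scales by the inverse of the
  conformal factor (\<open>trace_conformal\<close>). The two traces contribute \<open>e\<^sup>-\<^sup>4\<^sup>f\<close> and the metric
  inside them \<open>e\<^sup>2\<^sup>f\<close>, which the factor \<open>e\<^sup>2\<^sup>f\<close> on the left-hand sides balances.

  The only analytic input is \<open>v(exp f) = exp(f p) v(f)\<close> for a derivation \<open>v\<close> at \<open>p\<close>
  (\<open>tangent_exp\<close>), which needs the smooth second order Taylor remainder of the exponential.
\<close>

section \<open>Functions of class $C^k$ on open sets of a Euclidean space\<close>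

lemma Ck_on_subset: "Ck_on k S f \<Longrightarrow> T \<subseteq> S \<Longrightarrow> Ck_on k T f"
  by (induction k arbitrary: f) (auto intro: continuous_on_subset)

text \<open>
  Openness is what makes this true: Frechet derivatives at a point of \<open>S\<close> see a full neighbourhood.
\<close>

lemma Ck_on_cong:
  assumes "open S" "\<And>x. x \<in> S \<Longrightarrow> f x = g x" "Ck_on k S f"
  shows "Ck_on k S g"
  using assms(2,3)
proof (induction k arbitrary: f g)
  case 0
  then show ?case by (simp cong: continuous_on_cong)
next
  case (Suc k)
  have transfer: "(g has_derivative f') (at x)" if "x \<in> S" "(f has_derivative f') (at x)" for x f'
    using has_derivative_transform_within_open[OF that(2) \<open>open S\<close> that(1)] Suc.prems(1) by simp
  have diff: "(f has_derivative frechet_derivative f (at x)) (at x)" if "x \<in> S" for x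
    using Suc.prems that by (simp add: frechet_derivative_works[symmetric])
  have eq: "frechet_derivative f (at x) = frechet_derivative g (at x)" if "x \<in> S" for x
    using frechet_derivative_at transfer[OF that diff[OF that]] by blast
  have "Ck_on k S (\<lambda>x. frechet_derivative g (at x) v)" for v
    by (rule Suc.IH[of "\<lambda>x. frechet_derivative f (at x) v"]) (use eq Suc.prems(2) in auto)
  then show ?case
    using transfer[OF _ diff] by (auto simp: differentiable_def)
qed

lemma Ck_on_SucD: "Ck_on (Suc k) S f \<Longrightarrow> Ck_on k S f"
proof (induction k arbitrary: f)
  case 0
  then show ?case
    by (auto intro!: continuous_at_imp_continuous_on differentiable_imp_continuous_within)
qed auto

lemma Ck_on_const: "Ck_on k S (\<lambda>x. c)"
  by (induction k arbitrary: c) auto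

lemma Ck_on_lin:
  fixes f g :: "'e::euclidean_space \<Rightarrow> real"
  assumes "open S" "Ck_on k S f" "Ck_on k S g"
  shows "Ck_on k S (\<lambda>x. a * f x + b * g x)"
  using assms(2,3)
proof (induction k arbitrary: f g)
  case 0
  then show ?case by (auto intro!: continuous_intros)
next
  case (Suc k)
  have D: "((\<lambda>x. a * f x + b * g x) has_derivative
      (\<lambda>v. a * frechet_derivative f (at x) v + b * frechet_derivative g (at x) v)) (at x)"
    if "x \<in> S" for x
    using Suc.prems that
    by (auto intro!: derivative_eq_intros simp: frechet_derivative_works)
  have "Ck_on k S (\<lambda>x. frechet_derivative (\<lambda>x. a * f x + b * g x) (at x) v)" for v
    by (rule Ck_on_cong[OF \<open>open S\<close> _ Suc.IH[of "\<lambda>x. frechet_derivative f (at x) v"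
            "\<lambda>x. frechet_derivative g (at x) v"]])
      (use Suc.prems in \<open>auto simp: frechet_derivative_at[OF D, symmetric]\<close>)
  then show ?case using D by (auto simp: differentiable_def)
qed

lemma Ck_on_mult:
  fixes f g :: "'e::euclidean_space \<Rightarrow> real"
  assumes "open S" "Ck_on k S f" "Ck_on k S g"
  shows "Ck_on k S (\<lambda>x. f x * g x)"
  using assms(2,3)
proof (induction k arbitrary: f g)
  case 0
  then show ?case by (auto intro!: continuous_intros)
next
  case (Suc k)
  have low: "Ck_on k S f" "Ck_on k S g"
    using Suc.prems by (auto intro: Ck_on_SucD simp del: Ck_on.simps)
  have D: "((\<lambda>x. f x * g x) has_derivative
      (\<lambda>v. 1 * (f x * frechet_derivative g (at x) v) + 1 * (frechet_derivative f (at x) v * g x))) (at x)"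
    if "x \<in> S" for x
    using Suc.prems that
    by (auto intro!: derivative_eq_intros simp: frechet_derivative_works)
  have "Ck_on k S (\<lambda>x. frechet_derivative (\<lambda>x. f x * g x) (at x) v)" for v
    by (rule Ck_on_cong[OF \<open>open S\<close> _ Ck_on_lin[OF \<open>open S\<close> Suc.IH[of f
            "\<lambda>x. frechet_derivative g (at x) v"] Suc.IH[of "\<lambda>x. frechet_derivative f (at x) v" g], of 1 1]])
      (use Suc.prems low in \<open>auto simp: frechet_derivative_at[OF D, symmetric]\<close>)
  then show ?case using D by (auto simp: differentiable_def)
qed

lemma Ck_on_compose:
  fixes f :: "'e::euclidean_space \<Rightarrow> real" and \<phi> :: "real \<Rightarrow> real"
  assumes "open S" "Ck_on k UNIV \<phi>" "Ck_on k S f"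
  shows "Ck_on k S (\<lambda>x. \<phi> (f x))"
  using assms(2,3)
proof (induction k arbitrary: \<phi>)
  case 0
  have "continuous_on UNIV \<phi>" "continuous_on S f" using 0 by auto
  then have "continuous_on S (\<lambda>x. \<phi> (f x))"
    by (rule continuous_on_compose2) blast
  then show ?case by (subst Ck_on.simps(1))
next
  case (Suc k)
  have low: "Ck_on k S f"
    using Suc.prems(2) by (rule Ck_on_SucD)
  have D: "((\<lambda>x. \<phi> (f x)) has_derivative
      (\<lambda>v. frechet_derivative \<phi> (at (f x)) 1 * frechet_derivative f (at x) v)) (at x)"
    if "x \<in> S" for x
  proof -
    have diff: "f differentiable (at x)" "\<phi> differentiable (at (f x))"
      using Suc.prems that by auto
    have "((\<lambda>x. \<phi> (f x)) has_derivative
      (\<lambda>v. frechet_derivative \<phi> (at (f x)) (frechet_derivative f (at x) v))) (at x)"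
      by (rule has_derivative_compose[OF diff(1)[unfolded frechet_derivative_works]
            diff(2)[unfolded frechet_derivative_works]])
    moreover have "(\<lambda>v. frechet_derivative \<phi> (at (f x)) (frechet_derivative f (at x) v)) =
        (\<lambda>v. frechet_derivative \<phi> (at (f x)) 1 * frechet_derivative f (at x) v)"
    proof
      fix v
      show "frechet_derivative \<phi> (at (f x)) (frechet_derivative f (at x) v) =
          frechet_derivative \<phi> (at (f x)) 1 * frechet_derivative f (at x) v"
        using linear_cmul[OF linear_frechet_derivative[OF diff(2)], of "frechet_derivative f (at x) v" 1]
        by simp
    qed
    ultimately show ?thesis by simp
  qed
  have "Ck_on k S (\<lambda>x. frechet_derivative (\<lambda>x. \<phi> (f x)) (at x) v)" for v
    by (rule Ck_on_cong[OF \<open>open S\<close> _ Ck_on_mult[OF \<open>open S\<close> Suc.IH[of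
            "\<lambda>t. frechet_derivative \<phi> (at t) 1"], of "\<lambda>x. frechet_derivative f (at x) v"]])
      (use Suc.prems low in \<open>auto simp: frechet_derivative_at[OF D, symmetric]\<close>)
  then show ?case using D by (auto simp: differentiable_def)
qed

text \<open>
  The derivative of an everywhere convergent power series is again such a series, so the
  induction on the order of differentiability has to run over all coefficient sequences at once.
\<close>

lemma smooth_powser:
  fixes c :: "nat \<Rightarrow> real"
  assumes "\<And>t. summable (\<lambda>n. c n * t ^ n)"
  shows "smooth_on UNIV (\<lambda>t. \<Sum>n. c n * t ^ n)"
proof -
  have deriv: "((\<lambda>t. \<Sum>n. c n * t ^ n) has_real_derivative (\<Sum>n. diffs c n * t ^ n)) (at t)"
    if "\<And>t. summable (\<lambda>n. c n * t ^ n)" for c :: "nat \<Rightarrow> real" and t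
    using that by (rule termdiffs_strong_converges_everywhere)
  have "Ck_on k UNIV (\<lambda>t. \<Sum>n. c n * t ^ n)" for k
    using assms
  proof (induction k arbitrary: c)
    case 0
    then show ?case
      by (auto intro!: DERIV_continuous_on deriv)
  next
    case (Suc k)
    have D: "((\<lambda>t. \<Sum>n. c n * t ^ n) has_derivative (\<lambda>v. v * (\<Sum>n. diffs c n * t ^ n))) (at t)" for t
      using deriv[OF Suc.prems, of t] by (simp add: has_field_derivative_def mult.commute[of _ "suminf _"])
    have "summable (\<lambda>n. diffs c n * t ^ n)" for t
      using Suc.prems by (intro termdiff_converges_all) auto
    then have "Ck_on k UNIV (\<lambda>t. v * (\<Sum>n. diffs c n * t ^ n))" for v
      using Ck_on_mult[OF open_UNIV Ck_on_const] Suc.IH by blast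
    then show ?case
      using D by (auto simp: differentiable_def frechet_derivative_at[OF D, symmetric])
  qed
  then show ?thesis by (simp add: smooth_on_def)
qed

lemma smooth_on_exp: "smooth_on UNIV (exp :: real \<Rightarrow> real)"
proof -
  have "smooth_on UNIV (\<lambda>t::real. \<Sum>n. inverse (fact n) * t ^ n)"
    by (rule smooth_powser) (rule summable_exp)
  then show ?thesis by (simp add: exp_def[abs_def])
qed

text \<open>
  The remainder \<open>r\<close> is the power series with coefficients \<open>1/(n+2)!\<close>. Its smoothness, also at
  \<open>0\<close>, lets a derivation act on the right-hand side.
\<close>

lemma exp_second_order:
  obtains r :: "real \<Rightarrow> real" where "smooth_on UNIV r" "\<And>t. exp t = 1 + t + t * t * r t"
proof
  let ?c = "\<lambda>n. inverse (fact (n + 2)) :: real"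
  have sum: "summable (\<lambda>n. ?c n * t ^ n)" for t
  proof (rule summable_comparison_test)
    show "summable (\<lambda>n. inverse (fact n) * \<bar>t\<bar> ^ n)" by (rule summable_exp)
    show "\<exists>N. \<forall>n\<ge>N. norm (?c n * t ^ n) \<le> inverse (fact n) * \<bar>t\<bar> ^ n"
      by (auto simp: abs_mult power_abs intro!: mult_right_mono le_imp_inverse_le fact_mono exI[of _ 0]
          simp del: fact_Suc)
  qed
  show "smooth_on UNIV (\<lambda>t. \<Sum>n. ?c n * t ^ n)" using sum by (rule smooth_powser)
  show "exp t = 1 + t + t * t * (\<Sum>n. ?c n * t ^ n)" for t
    using exp_first_two_terms[of t] suminf_mult[OF sum[of t], of "t * t"]
    by (simp add: mult_ac power2_eq_square power_add)
qed

section \<open>Smooth functions on a manifold\<close>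

locale smooth_manifold =
  fixes A :: "('a::{t2_space,second_countable_topology}, 'e::euclidean_space) atlas"
  assumes atlas: "smooth_atlas A"
begin

lemma chart_image_open:
  assumes "(U, \<phi>) \<in> A" "open W"
  shows "open (\<phi> ` (U \<inter> W))"
proof -
  have hom: "open (\<phi> ` U)" "homeomorphism U (\<phi> ` U) \<phi> (inv_into U \<phi>)"
    using atlas assms(1) by (auto simp: smooth_atlas_def)
  then have "openin (top_of_set (\<phi> ` U)) (\<phi> ` (U \<inter> W))"
    using homeomorphism_imp_open_map[of U "\<phi> ` U" \<phi> "inv_into U \<phi>" "U \<inter> W"] assms(2) by blast
  then show ?thesis using hom(1) openin_open_trans by blast
qed

lemma chart_inverse: "(U, \<phi>) \<in> A \<Longrightarrow> p \<in> U \<Longrightarrow> inv_into U \<phi> (\<phi> p) = p"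
  using atlas by (fastforce simp: smooth_atlas_def homeomorphism_def)

lemma smooth_funI:
  assumes "open W" "\<And>U \<phi> k. (U, \<phi>) \<in> A \<Longrightarrow> open (\<phi> ` (U \<inter> W)) \<Longrightarrow> Ck_on k (\<phi> ` (U \<inter> W)) (\<lambda>x. h (inv_into U \<phi> x))"
  shows "smooth_fun A W h"
  using assms chart_image_open[OF _ assms(1)] by (auto simp: smooth_fun_def smooth_on_def o_def)

lemma smooth_funD:
  assumes "smooth_fun A W h" "(U, \<phi>) \<in> A"
  shows "Ck_on k (\<phi> ` (U \<inter> W)) (\<lambda>x. h (inv_into U \<phi> x))"
  using assms by (auto simp: smooth_fun_def smooth_on_def o_def)

lemma smooth_fun_open: "smooth_fun A W h \<Longrightarrow> open W"
  by (simp add: smooth_fun_def)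

lemma smooth_fun_subset: "smooth_fun A W h \<Longrightarrow> open V \<Longrightarrow> V \<subseteq> W \<Longrightarrow> smooth_fun A V h"
  by (rule smooth_funI) (auto intro: Ck_on_subset[OF smooth_funD, of W])

lemma smooth_fun_cong: "smooth_fun A W h \<Longrightarrow> (\<And>q. q \<in> W \<Longrightarrow> h q = k q) \<Longrightarrow> smooth_fun A W k"
  by (rule smooth_funI)
    (auto simp: smooth_fun_open chart_inverse intro!: Ck_on_cong[OF _ _ smooth_funD[of W h]])

lemma smooth_fun_const: "open W \<Longrightarrow> smooth_fun A W (\<lambda>q. c)"
  by (rule smooth_funI) (auto intro: Ck_on_const)

lemma smooth_fun_lin:
  "smooth_fun A W h \<Longrightarrow> smooth_fun A W k \<Longrightarrow> smooth_fun A W (\<lambda>q. a * h q + b * k q)"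
  by (rule smooth_funI) (auto intro!: Ck_on_lin intro: smooth_funD simp: smooth_fun_open)

lemma smooth_fun_mult:
  "smooth_fun A W h \<Longrightarrow> smooth_fun A W k \<Longrightarrow> smooth_fun A W (\<lambda>q. h q * k q)"
  by (rule smooth_funI) (auto intro!: Ck_on_mult intro: smooth_funD simp: smooth_fun_open)

lemma smooth_fun_compose:
  fixes \<phi> :: "real \<Rightarrow> real"
  shows "smooth_on UNIV \<phi> \<Longrightarrow> smooth_fun A W h \<Longrightarrow> smooth_fun A W (\<lambda>q. \<phi> (h q))"
  by (rule smooth_funI)
    (simp add: smooth_fun_open, rule Ck_on_compose[OF _ _ smooth_funD], auto simp: smooth_on_def)

lemma smooth_fun_add: "smooth_fun A W h \<Longrightarrow> smooth_fun A W k \<Longrightarrow> smooth_fun A W (\<lambda>q. h q + k q)"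
  using smooth_fun_lin[of W h k 1 1] by simp

lemma smooth_fun_diff: "smooth_fun A W h \<Longrightarrow> smooth_fun A W k \<Longrightarrow> smooth_fun A W (\<lambda>q. h q - k q)"
  using smooth_fun_lin[of W h k 1 "-1"] by simp

lemma smooth_fun_minus: "smooth_fun A W h \<Longrightarrow> smooth_fun A W (\<lambda>q. - h q)"
  using smooth_fun_lin[of W h h "-1" 0] by simp

lemma smooth_nearI: "smooth_fun A W h \<Longrightarrow> p \<in> W \<Longrightarrow> smooth_near A p h"
  by (auto simp: smooth_near_def)

lemma smooth_near_common:
  assumes "smooth_near A p h" "smooth_near A p k"
  obtains W where "p \<in> W" "smooth_fun A W h" "smooth_fun A W k"
proof -
  obtain U V where "p \<in> U" "smooth_fun A U h" "p \<in> V" "smooth_fun A V k"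
    using assms by (auto simp: smooth_near_def)
  then show ?thesis
    using that[of "U \<inter> V"] smooth_fun_subset[of _ _ "U \<inter> V"] smooth_fun_open
    by (metis IntI Int_lower1 Int_lower2 open_Int)
qed

lemma smooth_near_lin:
  "smooth_near A p h \<Longrightarrow> smooth_near A p k \<Longrightarrow> smooth_near A p (\<lambda>q. a * h q + b * k q)"
  by (metis smooth_near_common smooth_fun_lin smooth_nearI)

lemma smooth_near_mult:
  "smooth_near A p h \<Longrightarrow> smooth_near A p k \<Longrightarrow> smooth_near A p (\<lambda>q. h q * k q)"
  by (metis smooth_near_common smooth_fun_mult smooth_nearI)

lemma smooth_near_const: "smooth_near A p (\<lambda>q. c)"
  using smooth_fun_const[of UNIV] smooth_nearI by blast

section \<open>Tangent vectors\<close>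

lemma tangent_zero_outside: "v \<in> tangent_space A p \<Longrightarrow> \<not> smooth_near A p h \<Longrightarrow> v h = 0"
  unfolding tangent_space_def by blast

lemma tangent_germ:
  assumes "v \<in> tangent_space A p" "smooth_fun A W h" "smooth_fun A W k" "p \<in> W"
    "\<And>q. q \<in> W \<Longrightarrow> h q = k q"
  shows "v h = v k"
proof -
  have "\<forall>\<^sub>F q in nhds p. h q = k q"
    using assms smooth_fun_open by (auto simp: eventually_nhds)
  then show ?thesis
    using assms smooth_nearI unfolding tangent_space_def by blast
qed

lemma tangent_lin:
  "v \<in> tangent_space A p \<Longrightarrow> smooth_near A p h \<Longrightarrow> smooth_near A p k \<Longrightarrow>
    v (\<lambda>q. a * h q + b * k q) = a * v h + b * v k"
  unfolding tangent_space_def by blast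

lemma tangent_mult:
  "v \<in> tangent_space A p \<Longrightarrow> smooth_near A p h \<Longrightarrow> smooth_near A p k \<Longrightarrow>
    v (\<lambda>q. h q * k q) = v h * k p + h p * v k"
  unfolding tangent_space_def by blast

lemma tangent_const: "v \<in> tangent_space A p \<Longrightarrow> v (\<lambda>q. c) = 0"
  using tangent_mult[of v p "\<lambda>q. 1" "\<lambda>q. 1"] tangent_lin[of v p "\<lambda>q. 1" "\<lambda>q. 1" c 0] smooth_near_const
  by simp

text \<open>
  With \<open>u = f - f(p)\<close>, expand \<open>exp f = exp(f p) (1 + u + u\<^sup>2 r(u))\<close>. Since \<open>u\<close> vanishes at \<open>p\<close>,
  Leibniz's rule kills the quadratic term, and a derivation annihilates constants.
\<close>

lemma tangent_exp:
  assumes v: "v \<in> tangent_space A p" and f: "smooth_fun A W f" "p \<in> W"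
  shows "v (\<lambda>q. exp (f q)) = exp (f p) * v f"
proof -
  obtain r :: "real \<Rightarrow> real" where r: "smooth_on UNIV r" "\<And>t. exp t = 1 + t + t * t * r t"
    by (rule exp_second_order) blast
  define u where "u q = f q - f p" for q
  have u: "smooth_fun A W u"
    unfolding u_def using f smooth_fun_diff smooth_fun_const smooth_fun_open by blast
  have uu: "smooth_near A p u" "smooth_near A p (\<lambda>q. u q * u q)" "smooth_near A p (\<lambda>q. r (u q))"
    "smooth_near A p (\<lambda>q. u q * u q * r (u q))" "smooth_near A p f"
    using smooth_fun_mult[OF u u] smooth_fun_mult[OF smooth_fun_mult[OF u u] smooth_fun_compose[OF r(1) u]]
      smooth_fun_compose[OF r(1) u] u f(1) by (simp_all add: smooth_nearI[OF _ f(2)])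
  have "v u = v f"
    unfolding u_def using tangent_lin[OF v uu(5) smooth_near_const, of 1 "-1" "f p"] tangent_const[OF v] by simp
  have u0: "u p = 0" by (simp add: u_def)
  have "v (\<lambda>q. u q * u q * r (u q)) = 0"
    using tangent_mult[OF v uu(2,3)] tangent_mult[OF v uu(1,1)] u0 by simp
  moreover have "(\<lambda>q. exp (f q)) =
    (\<lambda>q. 1 * (exp (f p) * 1 + exp (f p) * u q) + exp (f p) * (u q * u q * r (u q)))"
  proof
    fix q
    have "exp (f q) = exp (f p) * exp (u q)" by (simp add: u_def exp_diff)
    then show "exp (f q) = 1 * (exp (f p) * 1 + exp (f p) * u q) + exp (f p) * (u q * u q * r (u q))"
      using r(2)[of "u q"] by (simp add: algebra_simps)
  qed
  ultimately show ?thesis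
    using tangent_lin[OF v smooth_near_lin[OF smooth_near_const uu(1), of "exp (f p)" 1 "exp (f p)"] uu(4), of 1 "exp (f p)"]
      tangent_lin[OF v smooth_near_const uu(1), of "exp (f p)" 1 "exp (f p)"] tangent_const[OF v] \<open>v u = v f\<close>
    by simp
qed

lemma tangent_space_lin:
  assumes "u \<in> tangent_space A p" "v \<in> tangent_space A p"
  shows "(\<lambda>h. a * u h + b * v h) \<in> tangent_space A p"
proof -
  have "a * u h + b * v h = a * u k + b * v k"
    if "smooth_near A p h" "smooth_near A p k" "\<forall>\<^sub>F q in nhds p. h q = k q" for h k
  proof -
    have "u h = u k" "v h = v k"
      using that assms unfolding tangent_space_def by blast+
    then show ?thesis by simp
  qed
  then show ?thesis
    by (auto simp: tangent_space_def tangent_zero_outside[OF assms(1)] tangent_zero_outside[OF assms(2)]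
        tangent_lin[OF assms(1)] tangent_lin[OF assms(2)] tangent_mult[OF assms(1)] tangent_mult[OF assms(2)]
        algebra_simps)
qed

lemma tangent_space_zero: "(\<lambda>h. 0) \<in> tangent_space A p"
  by (auto simp: tangent_space_def)

section \<open>Vector fields\<close>

lemma vector_field_open: "vector_field A U X \<Longrightarrow> open U"
  by (simp add: vector_field_def)

lemma vector_field_tangent: "vector_field A U X \<Longrightarrow> p \<in> U \<Longrightarrow> X p \<in> tangent_space A p"
  by (simp add: vector_field_def)

lemma vector_field_smooth: "vector_field A U X \<Longrightarrow> smooth_fun A U h \<Longrightarrow> smooth_fun A U (\<lambda>p. X p h)"
  by (simp add: vector_field_def)

lemma vector_field_subset: "vector_field A U X \<Longrightarrow> open V \<Longrightarrow> V \<subseteq> U \<Longrightarrow> vector_field A V X"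
  unfolding vector_field_def by blast

lemma vector_field_cong:
  assumes "vector_field A U X" "\<And>p. p \<in> U \<Longrightarrow> X p = Y p"
  shows "vector_field A U Y"
proof -
  have "smooth_fun A V (\<lambda>p. Y p h)" if "V \<subseteq> U" "smooth_fun A V h" for V h
    by (rule smooth_fun_cong[of V "\<lambda>p. X p h"])
       (use assms that in \<open>auto simp: vector_field_def subset_iff\<close>)
  then show ?thesis using assms by (auto simp: vector_field_def)
qed

lemma vector_field_zero: "open U \<Longrightarrow> vector_field A U (\<lambda>p h. 0)"
  by (auto simp: vector_field_def tangent_space_zero smooth_fun_const smooth_fun_open)

lemma vector_field_lin:
  assumes "smooth_fun A U a" "smooth_fun A U b" "vector_field A U X" "vector_field A U Y"
  shows "vector_field A U (vf_lin a X b Y)"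
proof -
  have "smooth_fun A V (\<lambda>p. vf_lin a X b Y p h)" if "V \<subseteq> U" "smooth_fun A V h" for V h
    unfolding vf_lin_def using that assms
    by (intro smooth_fun_add smooth_fun_mult)
      (auto intro: smooth_fun_subset smooth_fun_open simp: vector_field_def)
  then show ?thesis
    using assms by (auto simp: vector_field_def vf_lin_def tangent_space_lin)
qed

lemma vector_field_sum:
  assumes "open U" "finite I" "\<And>i. i \<in> I \<Longrightarrow> smooth_fun A U (c i) \<and> vector_field A U (X i)"
  shows "vector_field A U (\<lambda>p h. \<Sum>i\<in>I. c i p * X i p h)"
  using assms(2,3)
proof (induction I)
  case empty
  then show ?case using assms(1) by (simp add: vector_field_zero)
next
  case (insert i I)
  have "vector_field A U (vf_lin (c i) (X i) (\<lambda>p. 1) (\<lambda>p h. \<Sum>i\<in>I. c i p * X i p h))"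
    using insert assms(1) by (intro vector_field_lin smooth_fun_const) auto
  then show ?case using insert by (simp add: vf_lin_def)
qed

lemma lie_bracket_apply:
  "smooth_near A p h \<Longrightarrow> lie_bracket A X Y p h = X p (\<lambda>q. Y q h) - Y p (\<lambda>q. X q h)"
  by (simp add: lie_bracket_def)

text \<open>
  In the commutator of two derivations the mixed products \<open>X(h) Y(k) + Y(h) X(k)\<close> cancel, so it
  satisfies Leibniz's rule. Most of the work is bookkeeping of germs: the functions \<open>q \<mapsto> Y q h\<close> are
  controlled only on a neighbourhood on which \<open>h\<close> is smooth.
\<close>

lemma vector_field_lie_bracket:
  assumes X: "vector_field A U X" and Y: "vector_field A U Y"
  shows "vector_field A U (lie_bracket A X Y)"
proof -
  have smooth: "smooth_fun A V (\<lambda>q. X q h)" "smooth_fun A V (\<lambda>q. Y q h)"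
    if "V \<subseteq> U" "smooth_fun A V h" for V h
    using that assms by (auto simp: vector_field_def)
  have germ: "lie_bracket A X Y p h = X p (\<lambda>q. Y q h) - Y p (\<lambda>q. X q h)"
    if "p \<in> U" "smooth_near A p h" for p h
    using that by (simp add: lie_bracket_def)
  have near: "\<exists>V. p \<in> V \<and> V \<subseteq> U \<and> smooth_fun A V h \<and> smooth_fun A V k"
    if p: "p \<in> U" and hk: "smooth_near A p h" "smooth_near A p k" for p h k
  proof -
    obtain W where "p \<in> W" "smooth_fun A W h" "smooth_fun A W k"
      by (rule smooth_near_common[OF hk])
    moreover have "open (W \<inter> U)"
      using \<open>smooth_fun A W h\<close> smooth_fun_open vector_field_open[OF X] by blast
    ultimately have "smooth_fun A (W \<inter> U) h" "smooth_fun A (W \<inter> U) k"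
      by (auto intro: smooth_fun_subset[of W _ "W \<inter> U"])
    then show ?thesis
      using p \<open>p \<in> W\<close> by (intro exI[of _ "W \<inter> U"]) simp
  qed
  have "lie_bracket A X Y p \<in> tangent_space A p" if p: "p \<in> U" for p
    unfolding tangent_space_def mem_Collect_eq
  proof (intro conjI allI impI; (elim conjE)?)
    note vp = vector_field_tangent[OF X p] vector_field_tangent[OF Y p]
    fix h k :: "'a \<Rightarrow> real"
    show "\<not> smooth_near A p h \<Longrightarrow> lie_bracket A X Y p h = 0" by (simp add: lie_bracket_def)
    assume h: "smooth_near A p h" and k: "smooth_near A p k"
    obtain V where V: "p \<in> V" "V \<subseteq> U" "smooth_fun A V h" "smooth_fun A V k"
      using near[OF p h k] by blast
    note XY = smooth[OF V(2,3)] smooth[OF V(2,4)]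
    note nXY = XY[THEN smooth_nearI, OF V(1)]
    have tan: "X q \<in> tangent_space A q" "Y q \<in> tangent_space A q" "smooth_near A q h" "smooth_near A q k"
      if "q \<in> V" for q
      using that V X Y smooth_nearI by (auto simp: vector_field_def)
    {
      assume "\<forall>\<^sub>F q in nhds p. h q = k q"
      then obtain S where S: "open S" "p \<in> S" "\<And>q. q \<in> S \<Longrightarrow> h q = k q"
        unfolding eventually_nhds by blast
      let ?W = "S \<inter> V"
      have "open ?W" using S(1) smooth_fun_open[OF V(3)] by blast
      then have W: "p \<in> ?W" "smooth_fun A ?W h" "smooth_fun A ?W k" "?W \<subseteq> U"
        using S V by (auto intro: smooth_fun_subset[of V _ ?W])
      have "X q h = X q k" "Y q h = Y q k" if "q \<in> ?W" for q
        using tangent_germ[OF tan(1) W(2,3) that] tangent_germ[OF tan(2) W(2,3) that] that S(3) by auto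
      then have "X p (\<lambda>q. Y q h) = X p (\<lambda>q. Y q k)" "Y p (\<lambda>q. X q h) = Y p (\<lambda>q. X q k)"
        using tangent_germ[OF vp(1) smooth(2)[OF W(4,2)] smooth(2)[OF W(4,3)] W(1)]
          tangent_germ[OF vp(2) smooth(1)[OF W(4,2)] smooth(1)[OF W(4,3)] W(1)] by auto
      then show "lie_bracket A X Y p h = lie_bracket A X Y p k"
        using germ[OF p] h k by simp
    }
    {
      fix a b :: real
      note V' = smooth_fun_lin[OF V(3,4), of a b]
      have "X p (\<lambda>q. Y q (\<lambda>q. a * h q + b * k q)) = X p (\<lambda>q. a * Y q h + b * Y q k)"
        by (rule tangent_germ[OF vp(1) smooth(2)[OF V(2) V'] smooth_fun_lin[OF XY(2,4)] V(1)])
          (simp add: tangent_lin[OF tan(2) tan(3,4)])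
      moreover have "Y p (\<lambda>q. X q (\<lambda>q. a * h q + b * k q)) = Y p (\<lambda>q. a * X q h + b * X q k)"
        by (rule tangent_germ[OF vp(2) smooth(1)[OF V(2) V'] smooth_fun_lin[OF XY(1,3)] V(1)])
          (simp add: tangent_lin[OF tan(1) tan(3,4)])
      ultimately show "lie_bracket A X Y p (\<lambda>q. a * h q + b * k q) =
          a * lie_bracket A X Y p h + b * lie_bracket A X Y p k"
        by (simp only: germ[OF p h] germ[OF p k] germ[OF p smooth_near_lin[OF h k]]
          tangent_lin[OF vp(1) nXY(2,4)] tangent_lin[OF vp(2) nXY(1,3)]) (simp add: algebra_simps)
    }
    note V' = smooth_fun_mult[OF V(3,4)]
    have "X p (\<lambda>q. Y q (\<lambda>q. h q * k q)) = X p (\<lambda>q. Y q h * k q + h q * Y q k)"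
      by (rule tangent_germ[OF vp(1) smooth(2)[OF V(2) V'] _ V(1)])
        (auto simp: tangent_mult[OF tan(2) tan(3,4)] intro!: smooth_fun_add smooth_fun_mult XY V)
    also have "\<dots> = X p (\<lambda>q. Y q h * k q) + X p (\<lambda>q. h q * Y q k)"
      using tangent_lin[OF vp(1) smooth_near_mult[OF nXY(2) k] smooth_near_mult[OF h nXY(4)], of 1 1] by simp
    finally have 1: "X p (\<lambda>q. Y q (\<lambda>q. h q * k q)) =
        X p (\<lambda>q. Y q h) * k p + Y p h * X p k + X p h * Y p k + h p * X p (\<lambda>q. Y q k)"
      using tangent_mult[OF vp(1) nXY(2) k] tangent_mult[OF vp(1) h nXY(4)] by simp
    have "Y p (\<lambda>q. X q (\<lambda>q. h q * k q)) = Y p (\<lambda>q. X q h * k q + h q * X q k)"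
      by (rule tangent_germ[OF vp(2) smooth(1)[OF V(2) V'] _ V(1)])
        (auto simp: tangent_mult[OF tan(1) tan(3,4)] intro!: smooth_fun_add smooth_fun_mult XY V)
    also have "\<dots> = Y p (\<lambda>q. X q h * k q) + Y p (\<lambda>q. h q * X q k)"
      using tangent_lin[OF vp(2) smooth_near_mult[OF nXY(1) k] smooth_near_mult[OF h nXY(3)], of 1 1] by simp
    finally have 2: "Y p (\<lambda>q. X q (\<lambda>q. h q * k q)) =
        Y p (\<lambda>q. X q h) * k p + X p h * Y p k + Y p h * X p k + h p * Y p (\<lambda>q. X q k)"
      using tangent_mult[OF vp(2) nXY(1) k] tangent_mult[OF vp(2) h nXY(3)] by simp
    show "lie_bracket A X Y p (\<lambda>q. h q * k q) = lie_bracket A X Y p h * k p + h p * lie_bracket A X Y p k"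
      by (simp only: germ[OF p h] germ[OF p k] germ[OF p smooth_near_mult[OF h k]] 1 2) (simp add: algebra_simps)
  qed
  moreover have "smooth_fun A V (\<lambda>p. lie_bracket A X Y p h)" if V: "V \<subseteq> U" "smooth_fun A V h" for V h
  proof (rule smooth_fun_cong)
    show "smooth_fun A V (\<lambda>p. X p (\<lambda>q. Y q h) - Y p (\<lambda>q. X q h))"
      by (intro smooth_fun_diff smooth V)
    show "X p (\<lambda>q. Y q h) - Y p (\<lambda>q. X q h) = lie_bracket A X Y p h" if "p \<in> V" for p
      using germ that V smooth_nearI by auto
  qed
  ultimately show ?thesis
    using vector_field_open[OF X] unfolding vector_field_def by blast
qed

end

text \<open>
  Linearity over smooth functions, with the scalars evaluated at \<open>p\<close>. Vector fields on \<open>W\<close> are total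
  functions, so independence of the values outside \<open>W\<close> has to be asked for separately.
\<close>

definition tensorial ::
  "('a::{t2_space,second_countable_topology}, 'e::euclidean_space) atlas \<Rightarrow> 'a set \<Rightarrow> 'a \<Rightarrow>
     ('a vfield \<Rightarrow> real) \<Rightarrow> bool" where
  "tensorial A W p t \<longleftrightarrow>
     (\<forall>X Y. vector_field A W X \<and> vector_field A W Y \<and> (\<forall>q\<in>W. X q = Y q) \<longrightarrow> t X = t Y) \<and>
     (\<forall>a b X Y. smooth_fun A W a \<and> smooth_fun A W b \<and> vector_field A W X \<and> vector_field A W Y \<longrightarrow>
        t (vf_lin a X b Y) = a p * t X + b p * t Y)"

context smooth_manifold begin

lemma tensorial_cong:
  "tensorial A W p t \<Longrightarrow> vector_field A W X \<Longrightarrow> (\<And>q. q \<in> W \<Longrightarrow> X q = Y q) \<Longrightarrow> t X = t Y"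
  unfolding tensorial_def using vector_field_cong by blast

lemma tensorial_sum:
  assumes t: "tensorial A W p t" and "open W" and "finite I"
    and "\<And>i. i \<in> I \<Longrightarrow> smooth_fun A W (c i) \<and> vector_field A W (X i)"
  shows "t (\<lambda>q h. \<Sum>i\<in>I. c i q * X i q h) = (\<Sum>i\<in>I. c i p * t (X i))"
  using assms(3,4)
proof (induction I)
  case empty
  let ?O = "\<lambda>q h. 0 :: real"
  have "t (vf_lin (\<lambda>q. 0) ?O (\<lambda>q. 0) ?O) = 0 * t ?O + 0 * t ?O"
    using t smooth_fun_const[OF \<open>open W\<close>] vector_field_zero[OF \<open>open W\<close>] unfolding tensorial_def by blast
  then show ?case by (simp add: vf_lin_def)
next
  case (insert i I)
  let ?S = "\<lambda>q h. \<Sum>i\<in>I. c i q * X i q h"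
  have S: "vector_field A W ?S" using insert \<open>open W\<close> by (intro vector_field_sum) auto
  have "t (vf_lin (c i) (X i) (\<lambda>q. 1) ?S) = c i p * t (X i) + 1 * t ?S"
    using t insert.prems S smooth_fun_const[OF \<open>open W\<close>, of 1] unfolding tensorial_def by blast
  then show ?case using insert by (simp add: vf_lin_def)
qed

lemma lie_bracket_swap: "lie_bracket A Y X p h = - lie_bracket A X Y p h"
  by (simp add: lie_bracket_def)

lemma lie_bracket_cong:
  assumes X: "vector_field A W X" and Y: "vector_field A W Y"
    and eq: "\<And>q. q \<in> W \<Longrightarrow> X' q = X q" "\<And>q. q \<in> W \<Longrightarrow> Y' q = Y q" and p: "p \<in> W"
  shows "lie_bracket A X' Y' p = lie_bracket A X Y p"
proof
  fix h
  show "lie_bracket A X' Y' p h = lie_bracket A X Y p h"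
  proof (cases "smooth_near A p h")
    case True
    then obtain V where V: "p \<in> V" "smooth_fun A V h" unfolding smooth_near_def by blast
    let ?V = "W \<inter> V"
    have oV: "open ?V" using smooth_fun_open[OF V(2)] vector_field_open[OF X] by blast
    have h: "smooth_fun A ?V h" using smooth_fun_subset[OF V(2) oV] by blast
    have XY: "vector_field A ?V X" "vector_field A ?V Y"
      using vector_field_subset[OF X oV] vector_field_subset[OF Y oV] by blast+
    have pV: "p \<in> ?V" using p V by simp
    have "X p (\<lambda>q. Y' q h) = X p (\<lambda>q. Y q h)"
      by (rule tangent_germ[OF vector_field_tangent[OF X p] smooth_fun_cong[OF vector_field_smooth[OF XY(2) h]]
            vector_field_smooth[OF XY(2) h] pV]) (simp_all add: eq)
    moreover have "Y p (\<lambda>q. X' q h) = Y p (\<lambda>q. X q h)"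
      by (rule tangent_germ[OF vector_field_tangent[OF Y p] smooth_fun_cong[OF vector_field_smooth[OF XY(1) h]]
            vector_field_smooth[OF XY(1) h] pV]) (simp_all add: eq)
    ultimately show ?thesis by (simp add: lie_bracket_def eq p)
  qed (simp add: lie_bracket_def)
qed

text \<open>
  The derivatives of the coefficients that appear here cancel in the curvature against those that Leibniz's
  rule for the connection produces.
\<close>

lemma lie_bracket_vf_lin_left:
  assumes X: "vector_field A W X" "vector_field A W X'" and Y: "vector_field A W Y"
    and ab: "smooth_fun A W a" "smooth_fun A W b" and p: "p \<in> W"
  shows "lie_bracket A (vf_lin a X b X') Y p =
     vf_lin (\<lambda>q. 1) (vf_lin a (lie_bracket A X Y) b (lie_bracket A X' Y))
       (\<lambda>q. -1) (vf_lin (\<lambda>q. Y q a) X (\<lambda>q. Y q b) X') p"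
proof
  fix h
  show "lie_bracket A (vf_lin a X b X') Y p h =
     vf_lin (\<lambda>q. 1) (vf_lin a (lie_bracket A X Y) b (lie_bracket A X' Y))
       (\<lambda>q. -1) (vf_lin (\<lambda>q. Y q a) X (\<lambda>q. Y q b) X') p h"
  proof (cases "smooth_near A p h")
    case True
    then obtain V where V: "p \<in> V" "smooth_fun A V h" unfolding smooth_near_def by blast
    let ?V = "W \<inter> V"
    have oV: "open ?V" using smooth_fun_open[OF V(2)] vector_field_open[OF Y] by blast
    have h: "smooth_fun A ?V h" using smooth_fun_subset[OF V(2) oV] by blast
    have pV: "p \<in> ?V" using p V by simp
    have near: "smooth_near A p (\<lambda>q. X q h)" "smooth_near A p (\<lambda>q. X' q h)"
      using vector_field_smooth[OF vector_field_subset[OF X(1) oV] h]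
        vector_field_smooth[OF vector_field_subset[OF X(2) oV] h] pV smooth_nearI by blast+
    have nab: "smooth_near A p a" "smooth_near A p b" using ab p smooth_nearI by blast+
    note Yp = vector_field_tangent[OF Y p]
    have "Y p (\<lambda>q. 1 * (a q * X q h) + 1 * (b q * X' q h)) =
        Y p a * X p h + a p * Y p (\<lambda>q. X q h) + Y p b * X' p h + b p * Y p (\<lambda>q. X' q h)"
      by (simp only: tangent_lin[OF Yp smooth_near_mult[OF nab(1) near(1)] smooth_near_mult[OF nab(2) near(2)]]
          tangent_mult[OF Yp nab(1) near(1)] tangent_mult[OF Yp nab(2) near(2)]) simp
    then show ?thesis
      by (simp add: lie_bracket_apply[OF True] vf_lin_def algebra_simps)
  next
    case False
    then show ?thesis
      by (simp add: lie_bracket_def vf_lin_def tangent_zero_outside[OF vector_field_tangent[OF X(1) p]]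
          tangent_zero_outside[OF vector_field_tangent[OF X(2) p]])
  qed
qed

end

section \<open>Connections and their curvature\<close>

locale affine_connection = smooth_manifold A
  for A :: "('a::{t2_space,second_countable_topology}, 'e::euclidean_space) atlas" +
  fixes D :: "'a vfield \<Rightarrow> 'a vfield \<Rightarrow> 'a vfield"
  assumes connection: "connection A D"
begin

lemmas connection_clauses = connection[unfolded connection_def, THEN conjunct1]
  connection[unfolded connection_def, THEN conjunct2, THEN conjunct1]
  connection[unfolded connection_def, THEN conjunct2, THEN conjunct2, THEN conjunct1]
  connection[unfolded connection_def, THEN conjunct2, THEN conjunct2, THEN conjunct2, THEN conjunct1]
  connection[unfolded connection_def, THEN conjunct2, THEN conjunct2, THEN conjunct2, THEN conjunct2]

lemma D_field: "vector_field A W X \<Longrightarrow> vector_field A W Y \<Longrightarrow> vector_field A W (D X Y)"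
  using connection_clauses(1)[rule_format, of W X Y] by simp

lemma D_cong:
  "vector_field A W X \<Longrightarrow> vector_field A W Y \<Longrightarrow> (\<And>q. q \<in> W \<Longrightarrow> X' q = X q) \<Longrightarrow>
    (\<And>q. q \<in> W \<Longrightarrow> Y' q = Y q) \<Longrightarrow> p \<in> W \<Longrightarrow> D X' Y' p = D X Y p"
  using connection_clauses(5)[rule_format, of W X Y X' Y' p] by simp

lemma D_lin_left:
  assumes "vector_field A W X" "vector_field A W X'" "vector_field A W Y"
    "smooth_fun A W a" "smooth_fun A W b" "p \<in> W"
  shows "D (vf_lin a X b X') Y p h = a p * D X Y p h + b p * D X' Y p h"
proof -
  have "D (vf_lin a X b X') Y p = vf_lin a (D X Y) b (D X' Y) p"
    using connection_clauses(2)[rule_format, of W X X' Y a b p] assms by simp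
  then show ?thesis by (simp add: vf_lin_def)
qed

lemma D_lin_right:
  assumes X: "vector_field A W X" and Y: "vector_field A W Y" "vector_field A W Y'"
    and ab: "smooth_fun A W a" "smooth_fun A W b" and p: "p \<in> W"
  shows "D X (vf_lin a Y b Y') p h =
    X p a * Y p h + a p * D X Y p h + (X p b * Y' p h + b p * D X Y' p h)"
proof -
  have scale: "vector_field A W (\<lambda>q h. a q * Y q h)" if "smooth_fun A W a" "vector_field A W Y" for a Y
    using vector_field_lin[OF that(1) smooth_fun_const that(2,2), of 0] smooth_fun_open[OF that(1)]
    by (simp add: vf_lin_def)
  have leibniz: "D X (\<lambda>q h. a q * Y q h) p = (\<lambda>h. X p a * Y p h + a p * D X Y p h)"
    if "smooth_fun A W a" "vector_field A W Y" for a Y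
    using connection_clauses(4)[rule_format, of W X Y a p] that X p by simp
  have "D X (\<lambda>q h. (\<lambda>q h. a q * Y q h) q h + (\<lambda>q h. b q * Y' q h) q h) p =
      (\<lambda>h. D X (\<lambda>q h. a q * Y q h) p h + D X (\<lambda>q h. b q * Y' q h) p h)"
    using connection_clauses(3)[rule_format, OF _ p] X scale[OF ab(1) Y(1)] scale[OF ab(2) Y(2)] by blast
  then show ?thesis
    by (simp add: vf_lin_def leibniz ab Y)
qed

lemma curvature_field:
  assumes "vector_field A W X" "vector_field A W Y" "vector_field A W Z"
  shows "vector_field A W (curvature A D X Y Z)"
proof -
  note c = smooth_fun_const[OF vector_field_open[OF assms(1)]]
  have "vector_field A W (vf_lin (\<lambda>q. 1) (vf_lin (\<lambda>q. 1) (D X (D Y Z)) (\<lambda>q. -1) (D Y (D X Z)))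
      (\<lambda>q. -1) (D (lie_bracket A X Y) Z))"
    by (intro vector_field_lin c D_field vector_field_lie_bracket assms)
  then show ?thesis by (simp add: vf_lin_def curvature_def)
qed

lemma curvature_swap:
  assumes "vector_field A W X" "vector_field A W Y" "vector_field A W Z" "p \<in> W"
  shows "curvature A D Y X Z p h = - curvature A D X Y Z p h"
proof -
  note c = smooth_fun_const[OF vector_field_open[OF assms(1)]]
  note B = vector_field_lie_bracket[OF assms(1,2)]
  have "D (lie_bracket A Y X) Z p = D (vf_lin (\<lambda>q. -1) (lie_bracket A X Y) (\<lambda>q. 0) (lie_bracket A X Y)) Z p"
    by (rule D_cong[OF vector_field_lin[OF c c B B] assms(3) _ _ assms(4)])
      (auto simp: vf_lin_def lie_bracket_swap[of Y X])
  then show ?thesis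
    by (simp add: curvature_def D_lin_left[OF B B assms(3) c c assms(4)])
qed

lemma curvature_cong:
  assumes "vector_field A W X" "vector_field A W Y" "vector_field A W Z" and p: "p \<in> W"
    and eq: "\<And>q. q \<in> W \<Longrightarrow> X' q = X q" "\<And>q. q \<in> W \<Longrightarrow> Y' q = Y q" "\<And>q. q \<in> W \<Longrightarrow> Z' q = Z q"
  shows "curvature A D X' Y' Z' p = curvature A D X Y Z p"
proof -
  have "D X' (D Y' Z') p = D X (D Y Z) p"
    by (intro D_cong[OF _ D_field _ _ p] D_cong[of W Y Z] assms)
  moreover have "D Y' (D X' Z') p = D Y (D X Z) p"
    by (intro D_cong[OF _ D_field _ _ p] D_cong[of W X Z] assms)
  moreover have "D (lie_bracket A X' Y') Z' p = D (lie_bracket A X Y) Z p"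
    by (intro D_cong[OF vector_field_lie_bracket _ _ _ p] lie_bracket_cong[of W X Y] assms)
  ultimately show ?thesis by (simp add: curvature_def)
qed

text \<open>
  The terms \<open>Y(a) D\<^sub>X Z\<close> and \<open>Y(b) D\<^sub>X' Z\<close> from Leibniz's rule for \<open>D\<^sub>Y\<close> cancel those from the
  bracket.
\<close>

lemma curvature_lin_first:
  assumes X: "vector_field A W X" "vector_field A W X'" and Y: "vector_field A W Y" and Z: "vector_field A W Z"
    and ab: "smooth_fun A W a" "smooth_fun A W b" and p: "p \<in> W"
  shows "curvature A D (vf_lin a X b X') Y Z p h =
    a p * curvature A D X Y Z p h + b p * curvature A D X' Y Z p h"
proof -
  note c = smooth_fun_const[OF vector_field_open[OF Y]]
  note Yab = vector_field_smooth[OF Y ab(1)] vector_field_smooth[OF Y ab(2)]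
  note B = vector_field_lie_bracket[OF X(1) Y] vector_field_lie_bracket[OF X(2) Y]
  note B' = vector_field_lin[OF ab B] vector_field_lin[OF Yab X]
  note DXZ = D_field[OF X(1) Z] D_field[OF X(2) Z]
  have 1: "D (vf_lin a X b X') (D Y Z) p h = a p * D X (D Y Z) p h + b p * D X' (D Y Z) p h"
    by (rule D_lin_left[OF X D_field[OF Y Z] ab p])
  have "D Y (D (vf_lin a X b X') Z) p = D Y (vf_lin a (D X Z) b (D X' Z)) p"
    by (rule D_cong[OF Y vector_field_lin[OF ab DXZ] _ _ p])
      (auto simp: fun_eq_iff D_lin_left[OF X Z ab] vf_lin_def[of a "D X Z"])
  then have 2: "D Y (D (vf_lin a X b X') Z) p h =
      Y p a * D X Z p h + a p * D Y (D X Z) p h + (Y p b * D X' Z p h + b p * D Y (D X' Z) p h)"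
    by (simp add: D_lin_right[OF Y DXZ ab p])
  have "D (lie_bracket A (vf_lin a X b X') Y) Z p =
      D (vf_lin (\<lambda>q. 1) (vf_lin a (lie_bracket A X Y) b (lie_bracket A X' Y))
        (\<lambda>q. -1) (vf_lin (\<lambda>q. Y q a) X (\<lambda>q. Y q b) X')) Z p"
    by (rule D_cong[OF vector_field_lin[OF c c B'] Z _ _ p]) (auto simp: lie_bracket_vf_lin_left[OF X Y ab])
  then have 3: "D (lie_bracket A (vf_lin a X b X') Y) Z p h =
      a p * D (lie_bracket A X Y) Z p h + b p * D (lie_bracket A X' Y) Z p h
      - (Y p a * D X Z p h + Y p b * D X' Z p h)"
    by (simp add: D_lin_left[OF B' Z c c p] D_lin_left[OF B Z ab p] D_lin_left[OF X Z Yab p])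
  show ?thesis unfolding curvature_def 1 2 3 by (simp add: algebra_simps)
qed

lemma curvature_lin_second:
  assumes "vector_field A W X" "vector_field A W Y" "vector_field A W Y'" "vector_field A W Z"
    and "smooth_fun A W a" "smooth_fun A W b" and "p \<in> W"
  shows "curvature A D X (vf_lin a Y b Y') Z p h =
    a p * curvature A D X Y Z p h + b p * curvature A D X Y' Z p h"
  using curvature_lin_first[of W Y Y' X Z a b p h]
    curvature_swap[of W "vf_lin a Y b Y'" X Z p h] curvature_swap[of W Y X Z p h]
    curvature_swap[of W Y' X Z p h] vector_field_lin[of W a b Y Y'] assms
  by simp

text \<open>
  The second derivatives of the coefficients combine to \<open>X(Y a) - Y(X a) = [X,Y] a\<close>, which is what the
  term \<open>D\<^bsub>[X,Y]\<^esub>\<close> subtracts; the products of first derivatives are symmetric in \<open>X\<close> and \<open>Y\<close>.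
\<close>

lemma curvature_lin_third:
  assumes X: "vector_field A W X" and Y: "vector_field A W Y" and Z: "vector_field A W Z" "vector_field A W Z'"
    and ab: "smooth_fun A W a" "smooth_fun A W b" and p: "p \<in> W"
  shows "curvature A D X Y (vf_lin a Z b Z') p h =
    a p * curvature A D X Y Z p h + b p * curvature A D X Y Z' p h"
proof -
  note c = smooth_fun_const[OF vector_field_open[OF Y]]
  have second: "D X (D Y (vf_lin a Z b Z')) p h =
      X p (\<lambda>q. Y q a) * Z p h + Y p a * D X Z p h + X p a * D Y Z p h + a p * D X (D Y Z) p h +
      (X p (\<lambda>q. Y q b) * Z' p h + Y p b * D X Z' p h + X p b * D Y Z' p h + b p * D X (D Y Z') p h)"
    if X: "vector_field A W X" and Y: "vector_field A W Y" for X Y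
  proof -
    note Yab = vector_field_smooth[OF Y ab(1)] vector_field_smooth[OF Y ab(2)]
    note DYZ = D_field[OF Y Z(1)] D_field[OF Y Z(2)]
    note V = vector_field_lin[OF Yab(1) ab(1) Z(1) DYZ(1)] vector_field_lin[OF Yab(2) ab(2) Z(2) DYZ(2)]
    have "D X (D Y (vf_lin a Z b Z')) p =
        D X (vf_lin (\<lambda>q. 1) (vf_lin (\<lambda>q. Y q a) Z a (D Y Z)) (\<lambda>q. 1) (vf_lin (\<lambda>q. Y q b) Z' b (D Y Z'))) p"
      by (rule D_cong[OF X vector_field_lin[OF c c V] _ _ p])
        (auto simp: fun_eq_iff D_lin_right[OF Y Z ab] vf_lin_def[of "\<lambda>q. 1"] vf_lin_def[of "\<lambda>q. Y q _"])
    then show ?thesis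
      by (simp add: D_lin_right[OF X V c c p] tangent_const[OF vector_field_tangent[OF X p]]
          D_lin_right[OF X Z(1) DYZ(1) Yab(1) ab(1) p] D_lin_right[OF X Z(2) DYZ(2) Yab(2) ab(2) p])
  qed
  have bracket: "lie_bracket A X Y p h = X p (\<lambda>q. Y q h) - Y p (\<lambda>q. X q h)" if "smooth_fun A W h" for h
    using lie_bracket_apply smooth_nearI[OF that p] by blast
  show ?thesis
    unfolding curvature_def second[OF X Y] second[OF Y X]
      D_lin_right[OF vector_field_lie_bracket[OF X Y] Z ab p] bracket[OF ab(1)] bracket[OF ab(2)]
    by (simp add: algebra_simps)
qed

end

section \<open>Orthonormal frames and traces\<close>

definition orthonormal_frame ::
  "('a::{t2_space,second_countable_topology}, 'e::euclidean_space) atlas \<Rightarrow>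
     ('a \<Rightarrow> 'a tangent \<Rightarrow> 'a tangent \<Rightarrow> real) \<Rightarrow> 'i set \<Rightarrow> 'a set \<Rightarrow> ('i \<Rightarrow> 'a vfield) \<Rightarrow> bool" where
  "orthonormal_frame A g I W e \<longleftrightarrow> open W \<and> finite I \<and> (\<forall>i\<in>I. vector_field A W (e i)) \<and>
     (\<forall>p\<in>W. \<forall>i\<in>I. \<forall>j\<in>I. g p (e i p) (e j p) = (if i = j then 1 else 0)) \<and>
     (\<forall>p\<in>W. \<forall>v\<in>tangent_space A p. \<exists>c. v = (\<lambda>h. \<Sum>i\<in>I. c i * e i p h))"

locale riemannian_manifold = smooth_manifold A
  for A :: "('a::{t2_space,second_countable_topology}, 'e::euclidean_space) atlas" +
  fixes g :: "'a \<Rightarrow> 'a tangent \<Rightarrow> 'a tangent \<Rightarrow> real"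
  assumes metric: "riemannian_metric A g"
begin

lemma metric_sym: "u \<in> tangent_space A p \<Longrightarrow> v \<in> tangent_space A p \<Longrightarrow> g p u v = g p v u"
  using metric unfolding riemannian_metric_def by blast

lemma metric_lin_left:
  "u \<in> tangent_space A p \<Longrightarrow> v \<in> tangent_space A p \<Longrightarrow> w \<in> tangent_space A p \<Longrightarrow>
    g p (\<lambda>h. a * u h + b * v h) w = a * g p u w + b * g p v w"
  using metric unfolding riemannian_metric_def by blast

lemma metric_lin_right:
  "u \<in> tangent_space A p \<Longrightarrow> v \<in> tangent_space A p \<Longrightarrow> w \<in> tangent_space A p \<Longrightarrow>
    g p w (\<lambda>h. a * u h + b * v h) = a * g p w u + b * g p w v"
  using metric_lin_left[of u p v w a b] metric_sym[of w p] tangent_space_lin[of u p v a b] by simp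

lemma metric_nondegenerate: "u \<in> tangent_space A p \<Longrightarrow> g p u u = 0 \<Longrightarrow> u = (\<lambda>h. 0)"
  using metric[unfolded riemannian_metric_def, THEN conjunct2, THEN conjunct2, THEN conjunct1, rule_format, of u p]
  by force

lemma metric_smooth:
  "vector_field A W X \<Longrightarrow> vector_field A W Y \<Longrightarrow> smooth_fun A W (\<lambda>p. g p (X p) (Y p))"
  using metric unfolding riemannian_metric_def by blast

lemma metric_sum_left:
  assumes "finite I" "\<And>i. i \<in> I \<Longrightarrow> u i \<in> tangent_space A p" "w \<in> tangent_space A p"
  shows "(\<lambda>h. \<Sum>i\<in>I. c i * u i h) \<in> tangent_space A p \<and>
    g p (\<lambda>h. \<Sum>i\<in>I. c i * u i h) w = (\<Sum>i\<in>I. c i * g p (u i) w)"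
  using assms(1,2)
proof (induction I)
  case empty
  then show ?case
    using metric_lin_left[of "\<lambda>h. 0" p "\<lambda>h. 0" w 0 0] tangent_space_zero assms(3) by simp
next
  case (insert i I)
  then show ?case
    using tangent_space_lin[of "u i" p "\<lambda>h. \<Sum>i\<in>I. c i * u i h" "c i" 1]
      metric_lin_left[of "u i" p "\<lambda>h. \<Sum>i\<in>I. c i * u i h" w "c i" 1] assms(3) by simp
qed

context
  fixes I :: "'i set" and W :: "'a set" and e :: "'i \<Rightarrow> 'a vfield"
  assumes frame: "orthonormal_frame A g I W e"
begin

lemma frame_tangent: "p \<in> W \<Longrightarrow> i \<in> I \<Longrightarrow> e i p \<in> tangent_space A p"
  using frame vector_field_tangent unfolding orthonormal_frame_def by blast

lemma frame_finite: "finite I"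
  using frame unfolding orthonormal_frame_def by blast

lemma frame_expansion:
  assumes p: "p \<in> W" and v: "v \<in> tangent_space A p"
  shows "v = (\<lambda>h. \<Sum>i\<in>I. g p v (e i p) * e i p h)"
proof -
  obtain c where c: "v = (\<lambda>h. \<Sum>i\<in>I. c i * e i p h)"
    using frame assms unfolding orthonormal_frame_def by blast
  have "g p v (e j p) = c j" if j: "j \<in> I" for j
  proof -
    have "g p v (e j p) = (\<Sum>i\<in>I. c i * g p (e i p) (e j p))"
      unfolding c using metric_sum_left[OF frame_finite _ frame_tangent[OF p j], of "\<lambda>i. e i p" c]
        frame_tangent[OF p] by simp
    also have "\<dots> = (\<Sum>i\<in>I. c i * (if i = j then 1 else 0))"
      using frame p j unfolding orthonormal_frame_def by (intro sum.cong) auto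
    finally show ?thesis using j frame_finite by (simp add: if_distrib[of "(*) _"] cong: if_cong)
  qed
  then show ?thesis by (subst c) simp
qed

lemma frame_parseval:
  assumes p: "p \<in> W" and v: "u \<in> tangent_space A p" "v \<in> tangent_space A p"
  shows "g p u v = (\<Sum>i\<in>I. g p u (e i p) * g p v (e i p))"
proof -
  have "g p (\<lambda>h. \<Sum>i\<in>I. g p u (e i p) * e i p h) v = (\<Sum>i\<in>I. g p u (e i p) * g p (e i p) v)"
    using metric_sum_left[OF frame_finite frame_tangent[OF p] v(2)] by simp
  then show ?thesis
    using frame_expansion[OF p v(1)] metric_sym[OF v(2) frame_tangent[OF p]] by simp
qed

text \<open>
  On \<open>W\<close> the field \<open>X\<close> is a combination of the frame with smooth coefficients \<open>g(X, e\<^sub>i)\<close>. In particular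
  \<open>t X\<close> depends on the value of \<open>X\<close> at \<open>p\<close> only.
\<close>

lemma tensorial_frame:
  assumes t: "tensorial A W p t" and p: "p \<in> W" and X: "vector_field A W X"
  shows "t X = (\<Sum>i\<in>I. g p (X p) (e i p) * t (e i))"
proof -
  have e: "\<And>i. i \<in> I \<Longrightarrow> smooth_fun A W (\<lambda>q. g q (X q) (e i q)) \<and> vector_field A W (e i)"
    using frame metric_smooth[OF X] unfolding orthonormal_frame_def by blast
  have "t X = t (\<lambda>q h. \<Sum>i\<in>I. g q (X q) (e i q) * e i q h)"
    by (rule tensorial_cong[OF t X]) (rule frame_expansion, auto intro: vector_field_tangent[OF X])
  also have "\<dots> = (\<Sum>i\<in>I. g p (X p) (e i p) * t (e i))"
    by (rule tensorial_sum[OF t vector_field_open[OF X] frame_finite e])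
  finally show ?thesis .
qed

end

text \<open>
  Let \<open>a\<^sub>i\<^sub>k = g(et\<^sub>i, e\<^sub>k)\<close>. Expanding \<open>b(et\<^sub>i, et\<^sub>i)\<close> in the frame \<open>e\<close> produces the sums
  \<open>\<Sum>\<^sub>i a\<^sub>i\<^sub>k a\<^sub>i\<^sub>l\<close>, and Parseval's identity for \<open>et\<close> with respect to \<open>gt = \<rho> g\<close> evaluates them to
  \<open>\<delta>\<^sub>k\<^sub>l / \<rho>\<close>.
\<close>

lemma trace_conformal:
  assumes gt: "riemannian_manifold A gt" "\<And>u v. gt p u v = \<rho> * g p u v" and "\<rho> \<noteq> 0" and p: "p \<in> W"
    and e: "orthonormal_frame A g I W e" and et: "orthonormal_frame A gt I W et"
    and b: "\<And>Y. vector_field A W Y \<Longrightarrow> tensorial A W p (\<lambda>X. b X Y)"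
      "\<And>X. vector_field A W X \<Longrightarrow> tensorial A W p (\<lambda>Y. b X Y)"
  shows "\<rho> * (\<Sum>i\<in>I. b (et i) (et i)) = (\<Sum>i\<in>I. b (e i) (e i))"
proof -
  interpret gt: riemannian_manifold A gt by fact
  define a where "a i k = g p (et i p) (e k p)" for i k
  have fields: "vector_field A W (e i)" "vector_field A W (et i)" if "i \<in> I" for i
    using e et that unfolding orthonormal_frame_def by blast+
  have tan: "e i p \<in> tangent_space A p" "et i p \<in> tangent_space A p" if "i \<in> I" for i
    using fields that p vector_field_tangent by blast+
  \<comment> \<open>Parseval for \<open>et\<close> carries \<open>\<rho>\<^sup>2\<close> on one side and \<open>\<rho>\<close> on the other.\<close>
  have orth: "\<rho> * (\<Sum>i\<in>I. a i k * a i l) = (if k = l then 1 else 0)" if kl: "k \<in> I" "l \<in> I" for k l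
  proof -
    have "\<rho> * g p (e k p) (e l p) = (\<Sum>i\<in>I. (\<rho> * g p (e k p) (et i p)) * (\<rho> * g p (e l p) (et i p)))"
      using gt.frame_parseval[OF et p tan(1)[OF kl(1)] tan(1)[OF kl(2)]] gt(2) by simp
    also have "\<dots> = \<rho> * (\<rho> * (\<Sum>i\<in>I. a i k * a i l))"
      unfolding sum_distrib_left
      by (rule sum.cong) (auto simp: a_def metric_sym[OF tan(2) tan(1)] kl)
    finally have "\<rho> * (\<Sum>i\<in>I. a i k * a i l) = g p (e k p) (e l p)"
      using \<open>\<rho> \<noteq> 0\<close> by simp
    then show ?thesis
      using e p kl unfolding orthonormal_frame_def by simp
  qed
  have swap: "(\<Sum>i\<in>I. \<Sum>k\<in>I. \<Sum>l\<in>I. F i k l) = (\<Sum>k\<in>I. \<Sum>l\<in>I. \<Sum>i\<in>I. F i k l)"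
    for F :: "_ \<Rightarrow> _ \<Rightarrow> _ \<Rightarrow> real"
    by (subst sum.swap) (intro sum.cong refl sum.swap)
  have "b (et i) (et i) = (\<Sum>k\<in>I. \<Sum>l\<in>I. a i k * a i l * b (e k) (e l))" if i: "i \<in> I" for i
  proof -
    have "b (et i) (et i) = (\<Sum>k\<in>I. a i k * b (e k) (et i))"
      unfolding a_def using tensorial_frame[OF e b(1) p] fields i by blast
    also have "\<dots> = (\<Sum>k\<in>I. a i k * (\<Sum>l\<in>I. a i l * b (e k) (e l)))"
    proof (rule sum.cong)
      fix k assume "k \<in> I"
      then have "b (e k) (et i) = (\<Sum>l\<in>I. a i l * b (e k) (e l))"
        unfolding a_def using tensorial_frame[OF e b(2)[of "e k"] p, of "et i"] fields i by blast
      then show "a i k * b (e k) (et i) = a i k * (\<Sum>l\<in>I. a i l * b (e k) (e l))" by simp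
    qed simp
    finally show ?thesis by (simp add: sum_distrib_left mult.assoc)
  qed
  then have "\<rho> * (\<Sum>i\<in>I. b (et i) (et i)) = \<rho> * (\<Sum>i\<in>I. \<Sum>k\<in>I. \<Sum>l\<in>I. a i k * a i l * b (e k) (e l))"
    by simp
  also have "\<dots> = \<rho> * (\<Sum>k\<in>I. \<Sum>l\<in>I. \<Sum>i\<in>I. a i k * a i l * b (e k) (e l))"
    by (rule arg_cong[OF swap])
  also have "\<dots> = (\<Sum>k\<in>I. \<Sum>l\<in>I. \<rho> * (\<Sum>i\<in>I. a i k * a i l) * b (e k) (e l))"
    by (simp add: sum_distrib_left sum_distrib_right mult.assoc)
  also have "\<dots> = (\<Sum>k\<in>I. \<Sum>l\<in>I. (if k = l then 1 else 0) * b (e k) (e l))"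
    using orth by (intro sum.cong) auto
  also have "\<dots> = (\<Sum>k\<in>I. b (e k) (e k))"
    using frame_finite[OF e] by (simp add: if_distrib[of "\<lambda>x. x * _"] cong: if_cong)
  finally show ?thesis .
qed

end

section \<open>Almost Hermitian manifolds and Chern connections\<close>

context riemannian_manifold begin

lemma tensorial_metric:
  assumes "u \<in> tangent_space A p" "p \<in> W"
  shows "tensorial A W p (\<lambda>X. g p u (X p))"
  unfolding tensorial_def
  using assms metric_lin_right[OF vector_field_tangent[OF _ assms(2)] vector_field_tangent[OF _ assms(2)] assms(1)]
  by (auto simp: vf_lin_def)

lemma curvature_tensorial:
  assumes D: "affine_connection A D" and p: "p \<in> W"
    and X: "vector_field A W X" and Y: "vector_field A W Y" and Z: "vector_field A W Z" and V: "vector_field A W V"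
  shows "tensorial A W p (\<lambda>X. g p (curvature A D X Y Z p) (V p))"
    and "tensorial A W p (\<lambda>Y. g p (curvature A D X Y Z p) (V p))"
    and "tensorial A W p (\<lambda>Z. g p (curvature A D X Y Z p) (V p))"
    and "tensorial A W p (\<lambda>V. g p (curvature A D X Y Z p) (V p))"
proof -
  interpret affine_connection A D by fact
  note Vp = vector_field_tangent[OF V p]
  note Rp = vector_field_tangent[OF curvature_field p]
  show "tensorial A W p (\<lambda>X. g p (curvature A D X Y Z p) (V p))"
    unfolding tensorial_def
  proof (intro conjI allI impI; elim conjE)
    fix X X' assume X: "vector_field A W X" "vector_field A W X'" and eq: "\<forall>q\<in>W. X q = X' q"
    have "curvature A D X Y Z p = curvature A D X' Y Z p"
      by (rule curvature_cong[OF X(2) Y Z p]) (auto simp: eq)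
    then show "g p (curvature A D X Y Z p) (V p) = g p (curvature A D X' Y Z p) (V p)" by simp
  next
    fix a b X X' assume ab: "smooth_fun A W a" "smooth_fun A W b" and X: "vector_field A W X" "vector_field A W X'"
    have "curvature A D (vf_lin a X b X') Y Z p =
        (\<lambda>h. a p * curvature A D X Y Z p h + b p * curvature A D X' Y Z p h)"
      by (rule ext) (rule curvature_lin_first[OF X Y Z ab p])
    then show "g p (curvature A D (vf_lin a X b X') Y Z p) (V p) =
        a p * g p (curvature A D X Y Z p) (V p) + b p * g p (curvature A D X' Y Z p) (V p)"
      using metric_lin_left[OF Rp[OF X(1) Y Z] Rp[OF X(2) Y Z] Vp] by simp
  qed
  show "tensorial A W p (\<lambda>Y. g p (curvature A D X Y Z p) (V p))"
    unfolding tensorial_def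
  proof (intro conjI allI impI; elim conjE)
    fix Y Y' assume Y: "vector_field A W Y" "vector_field A W Y'" and eq: "\<forall>q\<in>W. Y q = Y' q"
    have "curvature A D X Y Z p = curvature A D X Y' Z p"
      by (rule curvature_cong[OF X Y(2) Z p]) (auto simp: eq)
    then show "g p (curvature A D X Y Z p) (V p) = g p (curvature A D X Y' Z p) (V p)" by simp
  next
    fix a b Y Y' assume ab: "smooth_fun A W a" "smooth_fun A W b" and Y: "vector_field A W Y" "vector_field A W Y'"
    have "curvature A D X (vf_lin a Y b Y') Z p =
        (\<lambda>h. a p * curvature A D X Y Z p h + b p * curvature A D X Y' Z p h)"
      by (rule ext) (rule curvature_lin_second[OF X Y Z ab p])
    then show "g p (curvature A D X (vf_lin a Y b Y') Z p) (V p) =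
        a p * g p (curvature A D X Y Z p) (V p) + b p * g p (curvature A D X Y' Z p) (V p)"
      using metric_lin_left[OF Rp[OF X Y(1) Z] Rp[OF X Y(2) Z] Vp] by simp
  qed
  show "tensorial A W p (\<lambda>Z. g p (curvature A D X Y Z p) (V p))"
    unfolding tensorial_def
  proof (intro conjI allI impI; elim conjE)
    fix Z Z' assume Z: "vector_field A W Z" "vector_field A W Z'" and eq: "\<forall>q\<in>W. Z q = Z' q"
    have "curvature A D X Y Z p = curvature A D X Y Z' p"
      by (rule curvature_cong[OF X Y Z(2) p]) (auto simp: eq)
    then show "g p (curvature A D X Y Z p) (V p) = g p (curvature A D X Y Z' p) (V p)" by simp
  next
    fix a b Z Z' assume ab: "smooth_fun A W a" "smooth_fun A W b" and Z: "vector_field A W Z" "vector_field A W Z'"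
    have "curvature A D X Y (vf_lin a Z b Z') p =
        (\<lambda>h. a p * curvature A D X Y Z p h + b p * curvature A D X Y Z' p h)"
      by (rule ext) (rule curvature_lin_third[OF X Y Z ab p])
    then show "g p (curvature A D X Y (vf_lin a Z b Z') p) (V p) =
        a p * g p (curvature A D X Y Z p) (V p) + b p * g p (curvature A D X Y Z' p) (V p)"
      using metric_lin_left[OF Rp[OF X Y Z(1)] Rp[OF X Y Z(2)] Vp] by simp
  qed
  show "tensorial A W p (\<lambda>V. g p (curvature A D X Y Z p) (V p))"
    by (rule tensorial_metric[OF Rp[OF X Y Z] p])
qed

text \<open>
  Both scalar curvatures are double traces of this kind, for different orders of the arguments of the
  curvature tensor.
\<close>

lemma double_trace_conformal:
  assumes gt: "riemannian_manifold A gt" "\<And>u v. gt p u v = \<rho> * g p u v" and "\<rho> \<noteq> 0" and p: "p \<in> W"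
    and e: "orthonormal_frame A g I W e" and et: "orthonormal_frame A gt I W et"
    and F: "\<And>X Y Z V. vector_field A W X \<Longrightarrow> vector_field A W Y \<Longrightarrow> vector_field A W Z \<Longrightarrow> vector_field A W V \<Longrightarrow>
      tensorial A W p (\<lambda>X. F X Y Z V) \<and> tensorial A W p (\<lambda>Y. F X Y Z V) \<and>
      tensorial A W p (\<lambda>Z. F X Y Z V) \<and> tensorial A W p (\<lambda>V. F X Y Z V)"
  shows "\<rho> * (\<rho> * (\<Sum>i\<in>I. \<Sum>j\<in>I. F (et i) (et i) (et j) (et j))) = (\<Sum>i\<in>I. \<Sum>j\<in>I. F (e i) (e i) (e j) (e j))"
proof -
  have fields: "vector_field A W (e i)" "vector_field A W (et i)" if "i \<in> I" for i
    using e et that unfolding orthonormal_frame_def by blast+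
  have inner: "\<rho> * (\<Sum>j\<in>I. F (et i) (et i) (et j) (et j)) = (\<Sum>j\<in>I. F (et i) (et i) (e j) (e j))"
    if i: "i \<in> I" for i
    by (rule trace_conformal[OF gt \<open>\<rho> \<noteq> 0\<close> p e et]) (use F fields(2)[OF i] in auto)
  have outer: "\<rho> * (\<Sum>i\<in>I. F (et i) (et i) (e j) (e j)) = (\<Sum>i\<in>I. F (e i) (e i) (e j) (e j))"
    if j: "j \<in> I" for j
    by (rule trace_conformal[OF gt \<open>\<rho> \<noteq> 0\<close> p e et, where b = "\<lambda>X Y. F X Y (e j) (e j)"])
      (use F fields(1)[OF j] in auto)
  have "\<rho> * (\<rho> * (\<Sum>i\<in>I. \<Sum>j\<in>I. F (et i) (et i) (et j) (et j))) =
      \<rho> * (\<Sum>i\<in>I. \<Sum>j\<in>I. F (et i) (et i) (e j) (e j))"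
    by (simp add: sum_distrib_left[of \<rho> _ I] inner[symmetric])
  also have "\<dots> = \<rho> * (\<Sum>j\<in>I. \<Sum>i\<in>I. F (et i) (et i) (e j) (e j))"
    by (subst sum.swap) (rule refl)
  also have "\<dots> = (\<Sum>j\<in>I. \<rho> * (\<Sum>i\<in>I. F (et i) (et i) (e j) (e j)))"
    by (rule sum_distrib_left)
  also have "\<dots> = (\<Sum>j\<in>I. \<Sum>i\<in>I. F (e i) (e i) (e j) (e j))"
    by (rule sum.cong) (auto simp: outer)
  also have "\<dots> = (\<Sum>i\<in>I. \<Sum>j\<in>I. F (e i) (e i) (e j) (e j))"
    by (rule sum.swap)
  finally show ?thesis .
qed

end

locale almost_hermitian_manifold = riemannian_manifold A g
  for A :: "('a::{t2_space,second_countable_topology}, 'e::euclidean_space) atlas"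
    and g :: "'a \<Rightarrow> 'a tangent \<Rightarrow> 'a tangent \<Rightarrow> real" +
  fixes J :: "'a \<Rightarrow> 'a tangent \<Rightarrow> 'a tangent"
  assumes complex: "almost_complex_structure A J"
    and orthogonal: "u \<in> tangent_space A p \<Longrightarrow> v \<in> tangent_space A p \<Longrightarrow> g p (J p u) (J p v) = g p u v"
begin

lemma J_tangent: "u \<in> tangent_space A p \<Longrightarrow> J p u \<in> tangent_space A p"
  using complex[unfolded almost_complex_structure_def, THEN conjunct1] by blast

lemma J_J: "u \<in> tangent_space A p \<Longrightarrow> J p (J p u) = (\<lambda>h. - u h)"
  using complex[unfolded almost_complex_structure_def, THEN conjunct1] by blast

lemma J_lin: "u \<in> tangent_space A p \<Longrightarrow> v \<in> tangent_space A p \<Longrightarrow>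
    J p (\<lambda>h. a * u h + b * v h) = (\<lambda>h. a * J p u h + b * J p v h)"
  using complex[unfolded almost_complex_structure_def, THEN conjunct2, THEN conjunct1] by simp

lemma J_neg: "u \<in> tangent_space A p \<Longrightarrow> J p (\<lambda>h. - u h) = (\<lambda>h. - J p u h)"
  using J_lin[of u p u "-1" 0] by simp

lemma J_field: "vector_field A W X \<Longrightarrow> vector_field A W (app_field J X)"
  using complex[unfolded almost_complex_structure_def, THEN conjunct2, THEN conjunct2] by simp

lemma J_vf_lin:
  "vector_field A W X \<Longrightarrow> vector_field A W Y \<Longrightarrow> p \<in> W \<Longrightarrow>
    J p (vf_lin a X b Y p) = vf_lin a (app_field J X) b (app_field J Y) p"
  using J_lin[of "X p" p "Y p" "a p" "b p"] vector_field_tangent by (simp add: vf_lin_def app_field_def)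

lemma metric_neg_left: "u \<in> tangent_space A p \<Longrightarrow> w \<in> tangent_space A p \<Longrightarrow> g p (\<lambda>h. - u h) w = - g p u w"
  using metric_lin_left[of u p u w "-1" 0] by simp

lemma J_skew:
  assumes "u \<in> tangent_space A p" "v \<in> tangent_space A p"
  shows "g p u (J p v) = - g p (J p u) v"
  using orthogonal[OF J_tangent[OF assms(1)] assms(2)] assms
  by (simp add: J_J metric_neg_left J_tangent)

lemma tensorial_J:
  assumes t: "tensorial A W p t"
  shows "tensorial A W p (\<lambda>X. t (app_field J X))"
  unfolding tensorial_def
proof (intro conjI allI impI; elim conjE)
  fix X Y assume "vector_field A W X" "\<forall>q\<in>W. X q = Y q"
  then show "t (app_field J X) = t (app_field J Y)"
    by (intro tensorial_cong[OF t J_field]) (auto simp: app_field_def)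
next
  fix a b X Y
  assume ab: "smooth_fun A W a" "smooth_fun A W b" and XY: "vector_field A W X" "vector_field A W Y"
  have "t (app_field J (vf_lin a X b Y)) = t (vf_lin a (app_field J X) b (app_field J Y))"
    by (rule tensorial_cong[OF t J_field[OF vector_field_lin[OF ab XY]]])
      (simp add: app_field_def[of J "vf_lin _ _ _ _"] J_vf_lin[OF XY])
  also have "\<dots> = a p * t (app_field J X) + b p * t (app_field J Y)"
    using t ab J_field[OF XY(1)] J_field[OF XY(2)] unfolding tensorial_def by simp
  finally show "t (app_field J (vf_lin a X b Y)) = a p * t (app_field J X) + b p * t (app_field J Y)" .
qed

lemma adapted_orthonormal_frame:
  assumes "adapted_frame A J g n U e" "open W" "W \<subseteq> U"
  shows "orthonormal_frame A g {1..2*n} W e"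
  using assms vector_field_subset[OF _ assms(2,3)]
  unfolding adapted_frame_def orthonormal_frame_def by (simp add: subset_iff)

end

locale chern_manifold = almost_hermitian_manifold A g J
  for A :: "('a::{t2_space,second_countable_topology}, 'e::euclidean_space) atlas"
    and g :: "'a \<Rightarrow> 'a tangent \<Rightarrow> 'a tangent \<Rightarrow> real"
    and J :: "'a \<Rightarrow> 'a tangent \<Rightarrow> 'a tangent" +
  fixes D :: "'a vfield \<Rightarrow> 'a vfield \<Rightarrow> 'a vfield"
  assumes chern: "is_chern_connection A J g D"

sublocale chern_manifold \<subseteq> affine_connection A D
  using chern[unfolded is_chern_connection_def, THEN conjunct1] by unfold_locales

context chern_manifold begin

lemma D_metric:
  "vector_field A W X \<Longrightarrow> vector_field A W Y \<Longrightarrow> vector_field A W Z \<Longrightarrow> p \<in> W \<Longrightarrow>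
    X p (\<lambda>q. g q (Y q) (Z q)) = g p (D X Y p) (Z p) + g p (Y p) (D X Z p)"
  using chern[unfolded is_chern_connection_def, THEN conjunct2, THEN conjunct1, rule_format, of W X Y Z p]
  by simp

lemma D_J:
  "vector_field A W X \<Longrightarrow> vector_field A W Y \<Longrightarrow> p \<in> W \<Longrightarrow> D X (app_field J Y) p = J p (D X Y p)"
  using chern[unfolded is_chern_connection_def, THEN conjunct2, THEN conjunct2, THEN conjunct1, rule_format, of W X Y p]
  by (simp add: app_field_def)

lemma D_torsion:
  "vector_field A W X \<Longrightarrow> vector_field A W Y \<Longrightarrow> p \<in> W \<Longrightarrow>
    D (app_field J X) (app_field J Y) p h - D (app_field J Y) (app_field J X) p h
      - lie_bracket A (app_field J X) (app_field J Y) p h =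
    - (D X Y p h - D Y X p h - lie_bracket A X Y p h)"
  using chern[unfolded is_chern_connection_def, THEN conjunct2, THEN conjunct2, THEN conjunct2, rule_format, of W X Y p]
  by (simp add: torsion_def fun_eq_iff)

text \<open>
  Locality and linearity of \<open>D\<close> in its first argument, applied to \<open>J J X = -X\<close>.
\<close>

lemma D_J_J:
  assumes X: "vector_field A W X" and Y: "vector_field A W Y" and p: "p \<in> W"
  shows "D (app_field J (app_field J X)) Y p h = - D X Y p h"
proof -
  note c = smooth_fun_const[OF vector_field_open[OF X]]
  have "D (app_field J (app_field J X)) Y p = D (vf_lin (\<lambda>q. -1) X (\<lambda>q. 0) X) Y p"
    by (rule D_cong[OF vector_field_lin[OF c c X X] Y _ _ p])
      (simp_all add: app_field_def vf_lin_def J_J[OF vector_field_tangent[OF X]])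
  then show ?thesis by (simp add: D_lin_left[OF X X Y c c p])
qed

end

section \<open>The Chern connection of a conformal metric\<close>

text \<open>
  Uniqueness of the Chern connection: \<open>b(X,Y,Z) = g(B\<^sub>X Y, Z)\<close> for the difference \<open>B\<close> of two metric and
  complex connections whose torsions differ by a \<open>J\<close>-anti-invariant tensor. Over the complex numbers,
  anti-invariance gives \<open>B\<^sub>x y' = B\<^sub>y' x\<close> for \<open>x\<close> of type \<open>(1,0)\<close> and \<open>y'\<close> of type \<open>(0,1)\<close>; the two sides
  have types \<open>(0,1)\<close> and \<open>(1,0)\<close>, so both vanish, and skewness takes care of the remaining
  components. The tensor \<open>c\<close> in the proof is twice the part of \<open>b\<close> of type \<open>(1,1)\<close> in its first two slots.

  The arguments range over an arbitrary set so that they can be vector fields on a common domain, with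
  \<open>b\<close> evaluated at one point.
\<close>

lemma chern_difference_vanishes:
  fixes b :: "'x \<Rightarrow> 'x \<Rightarrow> 'x \<Rightarrow> real"
  assumes j: "\<And>X. X \<in> S \<Longrightarrow> j X \<in> S"
    and skew: "\<And>X Y Z. X \<in> S \<Longrightarrow> Y \<in> S \<Longrightarrow> Z \<in> S \<Longrightarrow> b X Z Y = - b X Y Z"
    and complex: "\<And>X Y Z. X \<in> S \<Longrightarrow> Y \<in> S \<Longrightarrow> Z \<in> S \<Longrightarrow> b X (j Y) (j Z) = b X Y Z"
    and torsion: "\<And>X Y Z. X \<in> S \<Longrightarrow> Y \<in> S \<Longrightarrow> Z \<in> S \<Longrightarrow>
      b (j X) (j Y) Z - b (j Y) (j X) Z = - (b X Y Z - b Y X Z)"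
    and jj: "\<And>X Y Z. X \<in> S \<Longrightarrow> Y \<in> S \<Longrightarrow> Z \<in> S \<Longrightarrow> b (j (j X)) Y Z = - b X Y Z"
      "\<And>X Y Z. X \<in> S \<Longrightarrow> Y \<in> S \<Longrightarrow> Z \<in> S \<Longrightarrow> b X (j (j Y)) Z = - b X Y Z"
    and S: "X \<in> S" "Y \<in> S" "Z \<in> S"
  shows "b X Y Z = 0"
proof -
  define c where "c X Y Z = b X Y Z + b (j X) (j Y) Z" for X Y Z
  have c_sym: "c X Y Z = c Y X Z" if "X \<in> S" "Y \<in> S" "Z \<in> S" for X Y Z
    using torsion[OF that] by (simp add: c_def)
  have j_move: "b X (j Y) Z = - b X Y (j Z)" if "X \<in> S" "Y \<in> S" "Z \<in> S" for X Y Z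
    using complex[of X "j Y" Z] jj(2)[of X Y "j Z"] that j by simp
  have c_complex: "c X (j Y) (j Z) = c X Y Z" if "X \<in> S" "Y \<in> S" "Z \<in> S" for X Y Z
    using that j by (simp add: c_def complex)
  have c_first: "c (j X) Y (j Z) = - c X Y Z" if "X \<in> S" "Y \<in> S" "Z \<in> S" for X Y Z
    using that j jj(1)[of X "j Y" "j Z"] j_move[of "j X" Y Z] by (simp add: c_def complex)
  \<comment> \<open>\<open>c(Y, JX, JZ)\<close> equals \<open>c(Y, X, Z) = c(X, Y, Z)\<close>, but also \<open>c(JX, Y, JZ) = - c(X, Y, Z)\<close>.\<close>
  have c0: "c X Y Z = 0" if "X \<in> S" "Y \<in> S" "Z \<in> S" for X Y Z
    using c_complex[of Y X Z] c_first[of X Y Z] c_sym[of Y X Z] c_sym[of "j X" Y "j Z"] that j by simp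
  \<comment> \<open>The terms with \<open>JX\<close> cancel, since \<open>b(JX, JY, Z)\<close> is symmetric in \<open>Y\<close> and \<open>Z\<close>.\<close>
  have "c X Y Z - c X Z Y = 2 * b X Y Z"
    using skew[OF S] skew[of "j X" "j Y" Z] j_move[of "j X" Z Y] S j by (simp add: c_def)
  then show ?thesis using c0 S by simp
qed

locale conformal_chern_manifold = chern_manifold A g J D
  for A :: "('a::{t2_space,second_countable_topology}, 'e::euclidean_space) atlas"
    and g :: "'a \<Rightarrow> 'a tangent \<Rightarrow> 'a tangent \<Rightarrow> real"
    and J :: "'a \<Rightarrow> 'a tangent \<Rightarrow> 'a tangent"
    and D :: "'a vfield \<Rightarrow> 'a vfield \<Rightarrow> 'a vfield" +
  fixes f :: "'a \<Rightarrow> real"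
    and gt :: "'a \<Rightarrow> 'a tangent \<Rightarrow> 'a tangent \<Rightarrow> real"
    and Dt :: "'a vfield \<Rightarrow> 'a vfield \<Rightarrow> 'a vfield"
  assumes f: "smooth_fun A UNIV f"
    and gt: "gt = (\<lambda>p u v. exp (2 * f p) * g p u v)"
    and chern_gt: "is_chern_connection A J gt Dt"
begin

lemma f_smooth: "open W \<Longrightarrow> smooth_fun A W f"
  using f smooth_fun_subset by blast

lemma conformal_factor_smooth: "open W \<Longrightarrow> smooth_fun A W (\<lambda>q. exp (2 * f q))"
  using smooth_fun_compose[OF smooth_on_exp smooth_fun_lin[OF f_smooth f_smooth, of W 2 0]] by simp

lemma conformal_riemannian: "riemannian_metric A gt"
proof -
  have "smooth_fun A W (\<lambda>p. gt p (X p) (Y p))" if "vector_field A W X" "vector_field A W Y" for W X Y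
    unfolding gt using smooth_fun_mult[OF conformal_factor_smooth metric_smooth[OF that]]
      vector_field_open[OF that(1)] by simp
  moreover have "gt p u u > 0" if "u \<in> tangent_space A p" "u \<noteq> (\<lambda>h. 0)" for p u
    using metric[unfolded riemannian_metric_def, THEN conjunct2, THEN conjunct2, THEN conjunct1, rule_format, of u p]
      that by (simp add: gt)
  ultimately show ?thesis
    unfolding riemannian_metric_def
    by (auto simp: gt metric_sym metric_lin_left algebra_simps)
qed

end

sublocale conformal_chern_manifold \<subseteq> conformal: chern_manifold A gt J Dt
  using conformal_riemannian complex chern_gt by unfold_locales (auto simp: gt orthogonal)

context conformal_chern_manifold begin

text \<open>
  The candidate \<open>D + df \<otimes> id + d\<^sup>c f \<otimes> J\<close> for the Chern connection of \<open>gt\<close>.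
\<close>

definition candidate :: "'a vfield \<Rightarrow> 'a vfield \<Rightarrow> 'a vfield" where
  "candidate X Y = vf_lin (\<lambda>q. 1) (D X Y) (\<lambda>q. 1)
     (vf_lin (\<lambda>q. X q f) Y (\<lambda>q. dc J f q (X q)) (app_field J Y))"

lemma candidate_apply:
  "candidate X Y p h = D X Y p h + (X p f * Y p h + dc J f p (X p) * J p (Y p) h)"
  by (simp add: candidate_def vf_lin_def app_field_def)

lemma df_smooth: "vector_field A W X \<Longrightarrow> smooth_fun A W (\<lambda>q. X q f)"
  using vector_field_smooth f_smooth vector_field_open by blast

lemma dc_smooth: "vector_field A W X \<Longrightarrow> smooth_fun A W (\<lambda>q. dc J f q (X q))"
  using smooth_fun_minus[OF df_smooth[OF J_field]] by (simp add: dc_def app_field_def)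

lemma candidate_field:
  assumes "vector_field A W X" "vector_field A W Y"
  shows "vector_field A W (candidate X Y)"
proof -
  note c = smooth_fun_const[OF vector_field_open[OF assms(1)]]
  show ?thesis
    unfolding candidate_def
    by (rule vector_field_lin[OF c c D_field[OF assms] vector_field_lin[OF df_smooth[OF assms(1)]
            dc_smooth[OF assms(1)] assms(2) J_field[OF assms(2)]]])
qed

lemma candidate_J:
  assumes X: "vector_field A W X" and Y: "vector_field A W Y" and p: "p \<in> W"
  shows "J p (candidate X Y p) h = D X (app_field J Y) p h + (X p f * J p (Y p) h - dc J f p (X p) * Y p h)"
proof -
  note c = smooth_fun_const[OF vector_field_open[OF X]]
  note tail = vector_field_lin[OF df_smooth[OF X] dc_smooth[OF X] Y J_field[OF Y]]
  have "J p (candidate X Y p) h = J p (D X Y p) h +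
      J p (vf_lin (\<lambda>q. X q f) Y (\<lambda>q. dc J f q (X q)) (app_field J Y) p) h"
    unfolding candidate_def J_vf_lin[OF D_field[OF X Y] tail p] by (simp add: vf_lin_def app_field_def)
  also have "J p (vf_lin (\<lambda>q. X q f) Y (\<lambda>q. dc J f q (X q)) (app_field J Y) p) h =
      X p f * J p (Y p) h - dc J f p (X p) * Y p h"
    unfolding J_vf_lin[OF Y J_field[OF Y] p]
    by (simp add: vf_lin_def app_field_def J_J[OF vector_field_tangent[OF Y p]])
  finally show ?thesis by (simp add: D_J[OF X Y p])
qed

lemma candidate_metric:
  assumes X: "vector_field A W X" and Y: "vector_field A W Y" and Z: "vector_field A W Z" and p: "p \<in> W"
  shows "g p (candidate X Y p) (Z p) =
    g p (D X Y p) (Z p) + (X p f * g p (Y p) (Z p) + dc J f p (X p) * g p (J p (Y p)) (Z p))"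
proof -
  note Yp = vector_field_tangent[OF Y p] and Zp = vector_field_tangent[OF Z p]
  have "candidate X Y p = (\<lambda>h. 1 * D X Y p h + 1 * (X p f * Y p h + dc J f p (X p) * J p (Y p) h))"
    by (simp add: fun_eq_iff candidate_apply)
  then show ?thesis
    using metric_lin_left[OF vector_field_tangent[OF D_field[OF X Y] p]
        tangent_space_lin[OF Yp J_tangent[OF Yp], of "X p f" "dc J f p (X p)"] Zp, of 1 1]
      metric_lin_left[OF Yp J_tangent[OF Yp] Zp, of "X p f" "dc J f p (X p)"] by simp
qed

text \<open>
  Comparing the compatibility of \<open>D\<close> with \<open>g\<close> and of \<open>Dt\<close> with \<open>gt\<close>: differentiating the conformal factor
  contributes \<open>2 df(X)\<close>.
\<close>

lemma conformal_metric_sum: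
  assumes X: "vector_field A W X" and Y: "vector_field A W Y" and Z: "vector_field A W Z" and p: "p \<in> W"
  shows "g p (Dt X Y p) (Z p) + g p (Y p) (Dt X Z p) =
    2 * (X p f * g p (Y p) (Z p)) + (g p (D X Y p) (Z p) + g p (Y p) (D X Z p))"
proof -
  note Xp = vector_field_tangent[OF X p]
  note W = vector_field_open[OF X]
  have f2: "smooth_fun A W (\<lambda>q. 2 * f q)"
    using smooth_fun_lin[OF f_smooth[OF W] f_smooth[OF W], of 2 0] by simp
  have "X p (\<lambda>q. 2 * f q) = 2 * X p f"
    using tangent_lin[OF Xp smooth_nearI[OF f_smooth[OF W] p] smooth_nearI[OF f_smooth[OF W] p], of 2 0] by simp
  then have "X p (\<lambda>q. exp (2 * f q)) = exp (2 * f p) * (2 * X p f)"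
    using tangent_exp[OF Xp f2 p] by simp
  then have "X p (\<lambda>q. gt q (Y q) (Z q)) = exp (2 * f p) *
      (2 * (X p f * g p (Y p) (Z p)) + (g p (D X Y p) (Z p) + g p (Y p) (D X Z p)))"
    unfolding gt tangent_mult[OF Xp smooth_nearI[OF conformal_factor_smooth[OF W] p]
        smooth_nearI[OF metric_smooth[OF Y Z] p]] D_metric[OF X Y Z p]
    by (simp only:) (simp add: algebra_simps)
  moreover have "X p (\<lambda>q. gt q (Y q) (Z q)) =
      exp (2 * f p) * (g p (Dt X Y p) (Z p) + g p (Y p) (Dt X Z p))"
    using conformal.D_metric[OF X Y Z p] by (simp add: gt algebra_simps)
  ultimately show ?thesis by simp
qed

text \<open>
  The difference of \<open>Dt\<close> and the candidate satisfies the hypotheses of \<open>chern_difference_vanishes\<close>.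
  Since \<open>d\<^sup>c f(JX) = df(X)\<close> and \<open>df(JX) = - d\<^sup>c f(X)\<close>, the extra terms of the candidate cancel in the torsion
  condition.
\<close>

theorem conformal_chern_connection:
  assumes X: "vector_field A W X" and Y: "vector_field A W Y" and p: "p \<in> W"
  shows "Dt X Y p = candidate X Y p"
proof -
  define B where "B X Y = vf_lin (\<lambda>q. 1) (Dt X Y) (\<lambda>q. -1) (candidate X Y)" for X Y
  have B: "B X Y p h = Dt X Y p h - candidate X Y p h" for X Y h
    by (simp add: B_def vf_lin_def)
  note c = smooth_fun_const[OF vector_field_open[OF X]]
  let ?S = "{X. vector_field A W X}"
  let ?b = "\<lambda>X Y Z. g p (B X Y p) (Z p)"
  have B_field: "vector_field A W (B X Y)" if "X \<in> ?S" "Y \<in> ?S" for X Y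
    unfolding B_def using vector_field_lin[OF c c conformal.D_field candidate_field, of X Y X Y] that by simp
  have Bp: "B X Y p \<in> tangent_space A p" if "X \<in> ?S" "Y \<in> ?S" for X Y
    using vector_field_tangent[OF B_field[OF that] p] .
  have tan: "X p \<in> tangent_space A p" if "X \<in> ?S" for X
    using that vector_field_tangent[of W X p] p by simp
  have B_metric: "?b X Y Z = g p (Dt X Y p) (Z p) - g p (candidate X Y p) (Z p)"
    if "X \<in> ?S" "Y \<in> ?S" "Z \<in> ?S" for X Y Z
  proof -
    have XY: "vector_field A W X" "vector_field A W Y" using that by auto
    have "B X Y p = (\<lambda>h. 1 * Dt X Y p h + (-1) * candidate X Y p h)"
      by (simp add: fun_eq_iff B)
    then show ?thesis
      using metric_lin_left[OF vector_field_tangent[OF conformal.D_field[OF XY] p]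
          vector_field_tangent[OF candidate_field[OF XY] p] tan[OF that(3)], of 1 "-1"] by simp
  qed
  have B_J: "B X (app_field J Y) p = J p (B X Y p)" if S: "X \<in> ?S" "Y \<in> ?S" for X Y
  proof -
    have V: "vector_field A W X" "vector_field A W Y" using S by auto
    note Yp = tan[OF S(2)]
    show ?thesis
      unfolding B_def J_vf_lin[OF conformal.D_field[OF V(1,2)] candidate_field[OF V(1,2)] p]
      by (simp add: fun_eq_iff vf_lin_def candidate_apply app_field_def[of J "Dt _ _"]
          app_field_def[of J "candidate _ _"] app_field_def[of J Y]
          candidate_J[OF V(1,2) p] conformal.D_J[OF V(1,2) p, unfolded app_field_def[of J Y]] J_J[OF Yp])
  qed
  have zero: "?b X Y Z = 0" if XYZ: "X \<in> ?S" "Y \<in> ?S" "Z \<in> ?S" for X Y Z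
  proof (rule chern_difference_vanishes[where b = ?b and j = "app_field J" and S = ?S])
    fix X Y Z assume S: "X \<in> ?S" "Y \<in> ?S" "Z \<in> ?S"
    then have V: "vector_field A W X" "vector_field A W Y" "vector_field A W Z" by auto
    note Xp = tan[OF S(1)] and Yp = tan[OF S(2)] and Zp = tan[OF S(3)]
    show "app_field J X \<in> ?S" using J_field[OF V(1)] by simp
    have "?b X Y Z + ?b X Z Y = 0"
      using conformal_metric_sum[OF V p]
      by (simp add: B_metric V candidate_metric[OF V p] candidate_metric[OF V(1,3,2) p]
          metric_sym[OF Yp vector_field_tangent[OF D_field[OF V(1,3)] p]]
          metric_sym[OF Yp vector_field_tangent[OF conformal.D_field[OF V(1,3)] p]]
          metric_sym[OF Zp Yp] J_skew[OF Zp Yp] metric_sym[OF J_tangent[OF Yp] Zp])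
    then show "?b X Z Y = - ?b X Y Z" by simp
    show "?b X (app_field J Y) (app_field J Z) = ?b X Y Z"
      by (simp add: app_field_def[of J Z] B_J[OF S(1,2)] orthogonal[OF Bp[OF S(1,2)] Zp])
    have lin: "?b X Y Z - ?b X' Y' Z = g p (\<lambda>h. B X Y p h - B X' Y' p h) (Z p)"
      if "X \<in> ?S" "Y \<in> ?S" "X' \<in> ?S" "Y' \<in> ?S" for X Y X' Y'
      using metric_lin_left[OF Bp[OF that(1,2)] Bp[OF that(3,4)] Zp, of 1 "-1"] by simp
    have JS: "app_field J X \<in> ?S" "app_field J Y \<in> ?S" using J_field V by auto
    have "B (app_field J X) (app_field J Y) p h - B (app_field J Y) (app_field J X) p h =
        B Y X p h - B X Y p h" for h
      using D_torsion[OF V(1,2) p, of h] conformal.D_torsion[OF V(1,2) p, of h]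
      by (simp add: B candidate_apply dc_def app_field_def[of J X, THEN fun_cong]
          app_field_def[of J Y, THEN fun_cong] J_J[OF Xp] J_J[OF Yp] algebra_simps)
    then show "?b (app_field J X) (app_field J Y) Z - ?b (app_field J Y) (app_field J X) Z =
        - (?b X Y Z - ?b Y X Z)"
      using lin[OF JS(1,2,2,1)] lin[OF S(2,1,1,2)] by simp
    have "B (app_field J (app_field J X)) Y p = (\<lambda>h. - B X Y p h)"
      by (simp add: fun_eq_iff B candidate_apply D_J_J[OF V(1,2) p] conformal.D_J_J[OF V(1,2) p]
          dc_def app_field_def[of J "app_field J X", THEN fun_cong] app_field_def[of J X, THEN fun_cong]
          J_J[OF Xp] J_neg[OF Xp])
    then show "?b (app_field J (app_field J X)) Y Z = - ?b X Y Z"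
      by (simp add: metric_neg_left[OF Bp[OF S(1,2)] Zp])
    show "?b X (app_field J (app_field J Y)) Z = - ?b X Y Z"
      by (simp add: B_J[OF S(1) JS(2)] B_J[OF S(1,2)] J_J[OF Bp[OF S(1,2)]] metric_neg_left[OF Bp[OF S(1,2)] Zp])
  qed (use XYZ in auto)
  \<comment> \<open>The difference is itself a vector field on \<open>W\<close>, so it may be paired with itself.\<close>
  have "B X Y p = (\<lambda>h. 0)"
    using zero[of X Y "B X Y"] X Y B_field Bp by (intro metric_nondegenerate) auto
  then show ?thesis by (simp add: fun_eq_iff B)
qed

text \<open>
  In \<open>Dt\<^sub>X Dt\<^sub>Y Z\<close>, the terms pairing a derivative of \<open>f\<close> with one of \<open>Z\<close> and the terms quadratic in the
  derivatives of \<open>f\<close> are symmetric in \<open>X\<close> and \<open>Y\<close>, because \<open>J\<close> is parallel. The others that involve \<open>f\<close>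
  combine with those from \<open>Dt\<^bsub>[X,Y]\<^esub> Z\<close> to \<open>d(df)(X,Y) Z + d(d\<^sup>c f)(X,Y) JZ\<close>, and \<open>d(df) = 0\<close>.
\<close>

theorem conformal_curvature:
  assumes X: "vector_field A W X" and Y: "vector_field A W Y" and Z: "vector_field A W Z" and p: "p \<in> W"
  shows "curvature A Dt X Y Z p h =
    curvature A D X Y Z p h + ext_deriv A (dc J f) X Y p * J p (Z p) h"
proof -
  note c = smooth_fun_const[OF vector_field_open[OF X]]
  have second: "Dt X (Dt Y Z) p h =
      D X (D Y Z) p h + X p (\<lambda>q. Y q f) * Z p h + Y p f * D X Z p h
      + X p (\<lambda>q. dc J f q (Y q)) * J p (Z p) h + dc J f p (Y p) * J p (D X Z p) h
      + X p f * (D Y Z p h + Y p f * Z p h + dc J f p (Y p) * J p (Z p) h)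
      + dc J f p (X p) * (J p (D Y Z p) h + Y p f * J p (Z p) h - dc J f p (Y p) * Z p h)"
    if X: "vector_field A W X" and Y: "vector_field A W Y" for X Y
  proof -
    note YZ = D_field[OF Y Z]
    note tail = vector_field_lin[OF df_smooth[OF Y] dc_smooth[OF Y] Z J_field[OF Z]]
    have eq: "Dt X (Dt Y Z) p = candidate X (candidate Y Z) p"
      unfolding conformal_chern_connection[OF X candidate_field[OF Y Z] p, symmetric]
      by (rule conformal.D_cong[OF X candidate_field[OF Y Z] _ _ p]) (auto simp: conformal_chern_connection[OF Y Z])
    have "Dt X (Dt Y Z) p h = D X (candidate Y Z) p h + (X p f * candidate Y Z p h + dc J f p (X p) * J p (candidate Y Z p) h)"
      unfolding eq by (rule candidate_apply)
    also have "D X (candidate Y Z) p h = D X (D Y Z) p h + X p (\<lambda>q. Y q f) * Z p h + Y p f * D X Z p h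
      + X p (\<lambda>q. dc J f q (Y q)) * J p (Z p) h + dc J f p (Y p) * J p (D X Z p) h"
      unfolding candidate_def D_lin_right[OF X YZ tail c c p] D_J[OF X Z p]
        D_lin_right[OF X Z J_field[OF Z] df_smooth[OF Y] dc_smooth[OF Y] p]
        tangent_const[OF vector_field_tangent[OF X p]]
      by (simp add: app_field_def)
    finally show ?thesis
      unfolding candidate_J[OF Y Z p] D_J[OF Y Z p]
      by (simp add: candidate_apply algebra_simps)
  qed
  have "Dt (lie_bracket A X Y) Z p h = D (lie_bracket A X Y) Z p h
      + (X p (\<lambda>q. Y q f) - Y p (\<lambda>q. X q f)) * Z p h + dc J f p (lie_bracket A X Y p) * J p (Z p) h"
    unfolding conformal_chern_connection[OF vector_field_lie_bracket[OF X Y] Z p] candidate_apply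
    using lie_bracket_apply[OF smooth_nearI[OF f], of p X Y] by simp
  then show ?thesis
    unfolding curvature_def ext_deriv_def second[OF X Y] second[OF Y X]
    by (simp add: algebra_simps)
qed

end

section \<open>Scalar curvatures\<close>

context conformal_chern_manifold begin

lemma conformal_curvature_metric:
  assumes X: "vector_field A W X" and Y: "vector_field A W Y" and Z: "vector_field A W Z"
    and V: "vector_field A W V" and p: "p \<in> W"
  shows "g p (curvature A Dt X Y Z p) (V p) =
    g p (curvature A D X Y Z p) (V p) + ext_deriv A (dc J f) X Y p * g p (J p (Z p)) (V p)"
proof -
  have "curvature A Dt X Y Z p =
      (\<lambda>h. 1 * curvature A D X Y Z p h + ext_deriv A (dc J f) X Y p * J p (Z p) h)"
    by (simp add: fun_eq_iff conformal_curvature[OF X Y Z p])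
  then show ?thesis
    using metric_lin_left[OF vector_field_tangent[OF curvature_field[OF X Y Z] p]
        J_tangent[OF vector_field_tangent[OF Z p]] vector_field_tangent[OF V p], of 1] by simp
qed

text \<open>
  As a component of the difference of two curvature tensors, \<open>dd\<^sup>c f\<close> inherits their tensoriality.
\<close>

lemma ddc_via_curvature:
  assumes X: "vector_field A W X" and Y: "vector_field A W Y" and Z: "vector_field A W Z" and p: "p \<in> W"
    and unit: "g p (Z p) (Z p) = 1"
  shows "ext_deriv A (dc J f) X Y p =
    g p (curvature A Dt X Y Z p) (app_field J Z p) - g p (curvature A D X Y Z p) (app_field J Z p)"
  using conformal_curvature_metric[OF X Y Z J_field[OF Z] p] unit
    orthogonal[OF vector_field_tangent[OF Z p] vector_field_tangent[OF Z p]]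
  by (simp add: app_field_def)

lemma ddc_tensorial:
  assumes Y: "vector_field A W Y" and Z: "vector_field A W Z" and p: "p \<in> W" and unit: "g p (Z p) (Z p) = 1"
  shows "tensorial A W p (\<lambda>X. ext_deriv A (dc J f) X Y p)"
proof -
  note t = curvature_tensorial(1)[OF _ p Y Y Z J_field[OF Z]]
  note tDt = t[OF conformal.affine_connection_axioms] and tD = t[OF affine_connection_axioms]
  show ?thesis
    unfolding tensorial_def
  proof (intro conjI allI impI; elim conjE)
    fix X X' assume X: "vector_field A W X" "vector_field A W X'" and "\<forall>q\<in>W. X q = X' q"
    then show "ext_deriv A (dc J f) X Y p = ext_deriv A (dc J f) X' Y p"
      using tensorial_cong[OF tDt X(1), of X'] tensorial_cong[OF tD X(1), of X']
      by (simp add: ddc_via_curvature[OF X(1) Y Z p unit] ddc_via_curvature[OF X(2) Y Z p unit])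
  next
    fix a b X X' assume ab: "smooth_fun A W a" "smooth_fun A W b" and X: "vector_field A W X" "vector_field A W X'"
    show "ext_deriv A (dc J f) (vf_lin a X b X') Y p =
        a p * ext_deriv A (dc J f) X Y p + b p * ext_deriv A (dc J f) X' Y p"
      unfolding ddc_via_curvature[OF X(1) Y Z p unit] ddc_via_curvature[OF X(2) Y Z p unit]
        ddc_via_curvature[OF vector_field_lin[OF ab X] Y Z p unit]
        tDt[unfolded tensorial_def, THEN conjunct2, rule_format, of a b X X', OF conjI[OF ab(1) conjI[OF ab(2) conjI[OF X]]]]
        tD[unfolded tensorial_def, THEN conjunct2, rule_format, of a b X X', OF conjI[OF ab(1) conjI[OF ab(2) conjI[OF X]]]]
      by (simp add: algebra_simps)
  qed
qed

lemma ddc_swap: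
  assumes X: "vector_field A W X" and Y: "vector_field A W Y" and p: "p \<in> W" 
  shows "ext_deriv A (dc J f) Y X p = - ext_deriv A (dc J f) X Y p"
proof -
  have "lie_bracket A Y X p = (\<lambda>h. - lie_bracket A X Y p h)"
    by (simp add: fun_eq_iff lie_bracket_swap[of Y X])
  then show ?thesis
    by (simp add: ext_deriv_def dc_def J_neg[OF vector_field_tangent[OF vector_field_lie_bracket[OF X Y] p]])
qed

context
  fixes n :: nat and W :: "'a set" and e et :: "nat \<Rightarrow> 'a vfield" and p :: 'a
  assumes e: "orthonormal_frame A g {1..2*n} W e" and et: "orthonormal_frame A gt {1..2*n} W et"
    and p: "p \<in> W"
begin

lemma frame_fields: "i \<in> {1..2*n} \<Longrightarrow> vector_field A W (e i)"
  using e unfolding orthonormal_frame_def by blast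

lemma frame_orthonormal: "i \<in> {1..2*n} \<Longrightarrow> j \<in> {1..2*n} \<Longrightarrow> g p (e i p) (e j p) = (if i = j then 1 else 0)"
  using e p unfolding orthonormal_frame_def by blast

lemma gt_at_p: "gt p u v = exp (2 * f p) * g p u v"
  by (simp add: gt)

text \<open>
  After both traces are moved to the frame \<open>e\<close>, each \<open>dd\<^sup>c f(e\<^sub>i, J e\<^sub>i)\<close> occurs once for every \<open>j\<close> with the
  factor \<open>g(J e\<^sub>j, J e\<^sub>j) = 1\<close>, that is \<open>2n\<close> times.
\<close>

lemma conformal_chern_scalar_curvature:
  "exp (2 * f p) * chern_scalar_curvature A J gt Dt n et p =
    chern_scalar_curvature A J g D n e p - real n * Lambda J n e (ext_deriv A (dc J f)) p"
proof -
  let ?I = "{1..2*n}" and ?\<rho> = "exp (2 * f p)"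
  let ?F = "\<lambda>X Y Z V. g p (curvature A Dt X (app_field J Y) Z p) (app_field J V p)"
  let ?dd = "\<lambda>i. ext_deriv A (dc J f) (e i) (app_field J (e i)) p"
  have tens: "tensorial A W p (\<lambda>X. ?F X Y Z V) \<and> tensorial A W p (\<lambda>Y. ?F X Y Z V) \<and>
      tensorial A W p (\<lambda>Z. ?F X Y Z V) \<and> tensorial A W p (\<lambda>V. ?F X Y Z V)"
    if V: "vector_field A W X" "vector_field A W Y" "vector_field A W Z" "vector_field A W V" for X Y Z V
  proof -
    note t = curvature_tensorial[OF conformal.affine_connection_axioms p]
    show ?thesis
      using t(1)[OF V(1) J_field[OF V(2)] V(3) J_field[OF V(4)]]
        tensorial_J[OF t(2)[OF V(1) J_field[OF V(2)] V(3) J_field[OF V(4)]]]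
        t(3)[OF V(1) J_field[OF V(2)] V(3) J_field[OF V(4)]]
        tensorial_J[OF t(4)[OF V(1) J_field[OF V(2)] V(3) J_field[OF V(4)]]] by blast
  qed
  have "?\<rho> * (?\<rho> * (\<Sum>i\<in>?I. \<Sum>j\<in>?I. ?F (et i) (et i) (et j) (et j))) =
      (\<Sum>i\<in>?I. \<Sum>j\<in>?I. ?F (e i) (e i) (e j) (e j))"
    by (rule double_trace_conformal[where F = ?F, OF conformal.riemannian_manifold_axioms gt_at_p _ p e et])
      (simp, rule tens)
  also have "\<dots> = (\<Sum>i\<in>?I. \<Sum>j\<in>?I.
      g p (curvature A D (e i) (app_field J (e i)) (e j) p) (J p (e j p)) + ?dd i)"
  proof (intro sum.cong refl)
    fix i j assume i: "i \<in> ?I" and j: "j \<in> ?I"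
    note ep = vector_field_tangent[OF frame_fields[OF j] p]
    show "?F (e i) (e i) (e j) (e j) =
        g p (curvature A D (e i) (app_field J (e i)) (e j) p) (J p (e j p)) + ?dd i"
      using conformal_curvature_metric[OF frame_fields[OF i] J_field[OF frame_fields[OF i]] frame_fields[OF j]
          J_field[OF frame_fields[OF j]] p] frame_orthonormal[OF j j] orthogonal[OF ep ep]
      by (simp add: app_field_def[of J "e j"])
  qed
  also have "\<dots> = (\<Sum>i\<in>?I. \<Sum>j\<in>?I. g p (curvature A D (e i) (app_field J (e i)) (e j) p) (J p (e j p)))
      + 2 * real n * (\<Sum>i\<in>?I. ?dd i)"
    by (simp add: sum.distrib sum_distrib_left)
  finally show ?thesis
    unfolding chern_scalar_curvature_def Lambda_def gt_at_p
    by (simp add: app_field_def[of J "et _"] sum_distrib_left[symmetric] algebra_simps)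
qed

text \<open>
  Here \<open>dd\<^sup>c f(e\<^sub>i, e\<^sub>j)\<close> comes with the factor \<open>g(J e\<^sub>j, e\<^sub>i)\<close>, and the sum over \<open>i\<close> recombines the first argument
  to \<open>J e\<^sub>j\<close>.
\<close>

lemma conformal_third_scalar_curvature:
  "exp (2 * f p) * third_scalar_curvature A gt Dt n et p =
    third_scalar_curvature A g D n e p - Lambda J n e (ext_deriv A (dc J f)) p"
proof -
  let ?I = "{1..2*n}" and ?\<rho> = "exp (2 * f p)"
  let ?F = "\<lambda>X Y Z V. g p (curvature A Dt X Z V p) (Y p)"
  let ?dd = "\<lambda>X Y. ext_deriv A (dc J f) X Y p"
  have tens: "tensorial A W p (\<lambda>X. ?F X Y Z V) \<and> tensorial A W p (\<lambda>Y. ?F X Y Z V) \<and>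
      tensorial A W p (\<lambda>Z. ?F X Y Z V) \<and> tensorial A W p (\<lambda>V. ?F X Y Z V)"
    if V: "vector_field A W X" "vector_field A W Y" "vector_field A W Z" "vector_field A W V" for X Y Z V
    using curvature_tensorial[OF conformal.affine_connection_axioms p V(1,3,4,2)] by blast
  have trace: "(\<Sum>i\<in>?I. ?dd (e i) (e j) * g p (J p (e j p)) (e i p)) = - ?dd (e j) (app_field J (e j))"
    if j: "j \<in> ?I" for j
  proof -
    note ej = frame_fields[OF j]
    have "?dd (app_field J (e j)) (e j) = (\<Sum>i\<in>?I. g p (app_field J (e j) p) (e i p) * ?dd (e i) (e j))"
      by (rule tensorial_frame[OF e ddc_tensorial[OF ej ej p] p J_field[OF ej]])
        (simp add: frame_orthonormal[OF j j])
    then show ?thesis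
      using ddc_swap[OF ej J_field[OF ej] p] by (simp add: app_field_def mult.commute)
  qed
  have "?\<rho> * (?\<rho> * (\<Sum>i\<in>?I. \<Sum>j\<in>?I. ?F (et i) (et i) (et j) (et j))) =
      (\<Sum>i\<in>?I. \<Sum>j\<in>?I. ?F (e i) (e i) (e j) (e j))"
    by (rule double_trace_conformal[where F = ?F, OF conformal.riemannian_manifold_axioms gt_at_p _ p e et])
      (simp, rule tens)
  also have "\<dots> = (\<Sum>i\<in>?I. \<Sum>j\<in>?I. g p (curvature A D (e i) (e j) (e j) p) (e i p)
      + ?dd (e i) (e j) * g p (J p (e j p)) (e i p))"
    by (intro sum.cong refl conformal_curvature_metric[OF _ _ _ _ p] frame_fields)
  also have "\<dots> = (\<Sum>i\<in>?I. \<Sum>j\<in>?I. g p (curvature A D (e i) (e j) (e j) p) (e i p))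
      + (\<Sum>j\<in>?I. \<Sum>i\<in>?I. ?dd (e i) (e j) * g p (J p (e j p)) (e i p))"
    by (simp only: sum.distrib) (subst (3) sum.swap, rule refl)
  also have "(\<Sum>j\<in>?I. \<Sum>i\<in>?I. ?dd (e i) (e j) * g p (J p (e j p)) (e i p)) =
      - (\<Sum>j\<in>?I. ?dd (e j) (app_field J (e j)))"
    unfolding sum_negf[symmetric] by (rule sum.cong[OF refl trace])
  finally show ?thesis
    unfolding third_scalar_curvature_def Lambda_def gt_at_p
    by (simp add: sum_distrib_left[symmetric] algebra_simps)
qed

end

end

lemma conformal_chern_manifoldI:
  assumes "almost_hermitian A J g F" "smooth_fun A UNIV f"
    and "gt = (\<lambda>p u v. exp (2 * f p) * g p u v)"
    and "is_chern_connection A J g D" "is_chern_connection A J gt Dt"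
  shows "conformal_chern_manifold A g J D f gt Dt"
  using assms unfolding almost_hermitian_def by unfold_locales simp_all



theorem corollary4p5:
  fixes A :: "('a::{t2_space,second_countable_topology}, 'e::euclidean_space) atlas"
    and J :: "'a \<Rightarrow> 'a tangent \<Rightarrow> 'a tangent"
    and g F gt :: "'a \<Rightarrow> 'a tangent \<Rightarrow> 'a tangent \<Rightarrow> real"
    and D Dt :: "'a vfield \<Rightarrow> 'a vfield \<Rightarrow> 'a vfield"
    and f :: "'a \<Rightarrow> real" and n :: nat
    and U V :: "'a set" and e et :: "nat \<Rightarrow> 'a vfield" and p :: 'a
  assumes "DIM('e) = 2 * n"
    and "almost_hermitian A J g F"
    and "smooth_fun A UNIV f"
    and "gt = (\<lambda>p u v. exp (2 * f p) * g p u v)"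
    and "is_chern_connection A J g D"
    and "is_chern_connection A J gt Dt"
    and "adapted_frame A J g n U e"
    and "adapted_frame A J gt n V et"
    and "p \<in> U" and "p \<in> V"
  shows "exp (2 * f p) * chern_scalar_curvature A J gt Dt n et p =
             chern_scalar_curvature A J g D n e p - real n * Lambda J n e (ext_deriv A (dc J f)) p \<and>
         exp (2 * f p) * third_scalar_curvature A gt Dt n et p =
             third_scalar_curvature A g D n e p - Lambda J n e (ext_deriv A (dc J f)) p"
proof (cases "n = 0")
  case True
  then show ?thesis
    by (simp add: chern_scalar_curvature_def third_scalar_curvature_def Lambda_def)
next
  case False
  interpret conformal_chern_manifold A g J D f gt Dt
    using assms(2-6) by (rule conformal_chern_manifoldI)
  \<comment> \<open>The frames have a member, whose domain is open; for \<open>n = 0\<close> nothing says that \<open>U\<close> and \<open>V\<close> are open.\<close>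
  have "1 \<in> {1..2*n}" using False by simp
  then have "open U" "open V"
    using assms(7,8) vector_field_open unfolding adapted_frame_def by blast+
  then have "open (U \<inter> V)" by blast
  note frames = adapted_orthonormal_frame[OF assms(7) this Int_lower1]
    conformal.adapted_orthonormal_frame[OF assms(8) this Int_lower2]
  have "p \<in> U \<inter> V" using assms(9,10) by blast
  with frames show ?thesis
    by (intro conjI conformal_chern_scalar_curvature conformal_third_scalar_curvature)
qed

end
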